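(* Let $\Omega\subset\mathbb{R}^d$ be a domain of finite Lebesgue measure, let $P\subset\mathbb{R}^n$ be a convex polytope with non-empty interior, let $R$ be the polytopal Legendre function with $\operatorname{dom}(R)=P$ defined in the context, and let $W\in\mathbb{R}^{r\times n}$, $\bm{b}\in\mathbb{R}^r$. Suppose that there exists a measurable $\bm{\eta}:\Omega\to\mathbb{R}^n$ such that $$\bm{\eta}(x)\in P\ \text{ for a.e. }x\in\Omega,\qquad \int_\Omega W\bm{\eta}\,dx\prec\bm{b}.$$ If $F:L^\infty(\Omega;\mathbb{R}^n)\to\mathbb{R}$ satisfies the differentiability assumption stated in the context (in particular $\nabla F(\bm{v})\in L^\infty(\Omega;\mathbb{R}^n)$ exists), $\bm{v}\in\mathring{\mathcal{K}}$ with $\nabla R(\bm{v})\in L^\infty(\Omega;\mathbb{R}^n)$, and $\alpha>0$, then the problem $$\min_{\bm{\eta}\in L^1(\Omega;\mathbb{R}^n)}\int_\Omega\alpha\nabla F(\bm{v})\cdot\bm{\eta}+\mathcal{D}_R(\bm{\eta},\bm{v})\,dx\quad\text{subject to}\quad\int_\Omega W\bm{\eta}\,dx\preccurlyeq\bm{b}$$ has a unique minimizer $\bm{\eta}^\star$. Furthermore, $\bm{\eta}^\star$ is uniformly bounded away from $\partial P$, so that $$\bm{\eta}^\star\in\mathring{\mathcal{K}}\quad\text{and}\quad\nabla R(\bm{\eta}^\star)\in L^\infty(\Omega;\mathbb{R}^n).$$ Consequently, the minimizer $\bm{\eta}^\star$ obtained in $L^1(\Omega;\mathbb{R}^n)$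 is also the unique minimizer of the same problem posed over $L^\infty(\Omega;\mathbb{R}^n)$.
   Context: $\bm{a}\preccurlyeq\bm{b}$ (resp. $\bm{a}\prec\bm{b}$) means $a_i\le b_i$ (resp. $a_i<b_i$) for every index $i$. Polytopal Legendre function: let $\bm{v}_1,\dots,\bm{v}_q\in\mathbb{R}^n$ be the vertices of $P$ and $V\in\mathbb{R}^{n\times q}$ the matrix with columns $\bm{v}_i$. Then $R:\mathbb{R}^n\to\mathbb{R}\cup\{+\infty\}$ is $$R(\bm{x})=\inf\Big\{\sum_{i=1}^q\lambda_i\ln\lambda_i\;\Big|\;\bm{\lambda}\in\mathbb{R}^q,\ \lambda_i\ge0,\ \sum_{i=1}^q\lambda_i=1,\ V\bm{\lambda}=\bm{x}\Big\},$$ with $0\ln0=0$ and $\inf\emptyset=+\infty$. It is differentiable on $\operatorname{int}(P)$. Its Bregman divergence is $\mathcal{D}_R(\bm{p},\bm{q})=R(\bm{p})-R(\bm{q})-\nabla R(\bm{q})\cdot(\bm{p}-\bm{q})\in[0,+\infty]$ for $\bm{p}\in\mathbb{R}^n$, $\bm{q}\in\operatorname{int}(P)$. Functions of vectors are applied pointwise to functions on $\Omega$: $\nabla R(\bm{v})(x)=\nabla R(\bm{v}(x))$, $\mathcal{D}_R(\bm{\eta},\bm{v})(x)=\mathcal{D}_R(\bm{\eta}(x),\bm{v}(x))$; the objective takes values in $\mathbb{R}\cup\{+\infty\}$. Constraint sets: $\mathcal{K}=\{\bm{\eta}\in L^\infty(\Omega;\mathbb{R}^n):\bm{\eta}(x)\in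 P\text{ for a.e. }x\in\Omega\}$; $\mathring{\mathcal{K}}=\{\bm{\eta}\in\mathcal{K}:\operatorname{ess\,inf}_{x\in\Omega}\operatorname{dist}(\bm{\eta}(x),\partial P)>0\}$, where $\operatorname{dist}$ is Euclidean distance; $\mathcal{M}=\{\bm{\eta}\in L^\infty(\Omega;\mathbb{R}^n):\int_\Omega W\bm{\eta}\,dx\preccurlyeq\bm{b}\}$; $\mathcal{A}=\mathcal{K}\cap\mathcal{M}$. Differentiability assumption: $F$ is continuously Fréchet differentiable on $\mathcal{A}$ and is Fréchet differentiable at $\bm{v}$, and at each such point $\bm{\eta}$ (in $\mathcal{A}$ or equal to $\bm{v}$) its derivative $F'(\bm{\eta})\in(L^\infty(\Omega;\mathbb{R}^n))'$ has a representative $\nabla F(\bm{\eta})\in L^\infty(\Omega;\mathbb{R}^n)$ characterized by $\int_\Omega\nabla F(\bm{\eta})\cdot\bm{q}\,dx=\langle F'(\bm{\eta}),\bm{q}\rangle$ for all $\bm{q}\in L^\infty(\Omega;\mathbb{R}^n)$. *)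

theory Defs
  imports "HOL-Probability.Essential_Supremum"
begin

section \<open>The polytopal Legendre function and its Bregman divergence\<close>

text \<open>The barycentric coordinates are indexed by the vertices themselves, so only the values of
  \<open>l\<close> on the vertex set matter. The convention \<open>0 ln 0 = 0\<close> is automatic, and the infimum over
  the empty set is \<open>\<infinity>\<close> in \<^typ>\<open>ereal\<close>.\<close>

definition polytopal_legendre :: "'a::euclidean_space set \<Rightarrow> 'a \<Rightarrow> ereal" where
  "polytopal_legendre P x =
     (let V = {v. v extreme_point_of P} in
      Inf {ereal (\<Sum>v\<in>V. l v * ln (l v)) | l :: 'a \<Rightarrow> real.
             (\<forall>v\<in>V. 0 \<le> l v) \<and> (\<Sum>v\<in>V. l v) = 1 \<and> (\<Sum>v\<in>V. l v *\<^sub>R v) = x})"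

text \<open>Meaningful only where the function is finite in a neighbourhood and differentiable; there
  \<^const>\<open>real_of_ereal\<close> loses nothing.\<close>

definition gradient :: "('a::euclidean_space \<Rightarrow> ereal) \<Rightarrow> 'a \<Rightarrow> 'a" where
  "gradient R x = (THE D. GDERIV (\<lambda>y. real_of_ereal (R y)) x :> D)"

text \<open>Used with \<open>R q\<close> finite only, so the subtractions in \<^typ>\<open>ereal\<close> are never \<open>\<infinity> - \<infinity>\<close>.\<close>

definition bregman :: "('a::euclidean_space \<Rightarrow> ereal) \<Rightarrow> 'a \<Rightarrow> 'a \<Rightarrow> ereal" where
  "bregman R p q = R p - R q - ereal (gradient R q \<bullet> (p - q))"

section \<open>Lebesgue spaces over a set\<close>

text \<open>The spaces \<open>L\<^sup>1\<close> and \<open>L\<^sup>\<infinity>\<close> are represented by their sets of representatives; equality in them is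
  equality almost everywhere on \<open>\<Omega>\<close>. Representatives are total functions whose values outside
  \<open>\<Omega>\<close> are irrelevant.\<close>

definition L1 :: "'d::euclidean_space set \<Rightarrow> ('d \<Rightarrow> 'a::euclidean_space) set" where
  "L1 \<Omega> = {f. integrable (lebesgue_on \<Omega>) f}"

definition Linf :: "'d::euclidean_space set \<Rightarrow> ('d \<Rightarrow> 'a::euclidean_space) set" where
  "Linf \<Omega> = {f. f \<in> borel_measurable (lebesgue_on \<Omega>) \<and>
                esssup (lebesgue_on \<Omega>) (\<lambda>x. ereal (norm (f x))) < \<infinity>}"

definition Linf_norm :: "'d::euclidean_space set \<Rightarrow> ('d \<Rightarrow> 'a::euclidean_space) \<Rightarrow> real" where
  "Linf_norm \<Omega> f = real_of_ereal (esssup (lebesgue_on \<Omega>) (\<lambda>x. ereal (norm (f x))))"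

definition essinf :: "'x measure \<Rightarrow> ('x \<Rightarrow> ereal) \<Rightarrow> ereal" where
  "essinf M f = - esssup M (\<lambda>x. - f x)"

text \<open>Integral of an extended-real function as the integral of the positive part minus that of the
  negative part (\<^const>\<open>e2ennreal\<close> sends negative values to \<open>0\<close>). In the objective below the
  negative part has a finite integral.\<close>

definition ext_integral :: "'x measure \<Rightarrow> ('x \<Rightarrow> ereal) \<Rightarrow> ereal" where
  "ext_integral M f =
     enn2ereal (\<integral>\<^sup>+ x. e2ennreal (f x) \<partial>M) - enn2ereal (\<integral>\<^sup>+ x. e2ennreal (- f x) \<partial>M)"

section \<open>Constraint sets\<close>

text \<open>The library's strict order on vectors is not the componentwise one, so both orders are
  spelled out.\<close>

definition vec_le :: "real ^ 'r \<Rightarrow> real ^ 'r \<Rightarrow> bool" where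
  "vec_le a b \<longleftrightarrow> (\<forall>i. a $ i \<le> b $ i)"

definition vec_less :: "real ^ 'r \<Rightarrow> real ^ 'r \<Rightarrow> bool" where
  "vec_less a b \<longleftrightarrow> (\<forall>i. a $ i < b $ i)"

definition W_integral ::
    "'d::euclidean_space set \<Rightarrow> real ^ 'n ^ 'r \<Rightarrow> ('d \<Rightarrow> real ^ 'n) \<Rightarrow> real ^ 'r" where
  "W_integral \<Omega> W \<eta> = (\<integral>x. W *v \<eta> x \<partial>(lebesgue_on \<Omega>))"

definition K_set :: "'d::euclidean_space set \<Rightarrow> 'a::euclidean_space set \<Rightarrow> ('d \<Rightarrow> 'a) set" where
  "K_set \<Omega> P = {\<eta> \<in> Linf \<Omega>. AE x in lebesgue_on \<Omega>. \<eta> x \<in> P}"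

definition K_ring :: "'d::euclidean_space set \<Rightarrow> 'a::euclidean_space set \<Rightarrow> ('d \<Rightarrow> 'a) set" where
  "K_ring \<Omega> P = {\<eta> \<in> K_set \<Omega> P.
      essinf (lebesgue_on \<Omega>) (\<lambda>x. ereal (infdist (\<eta> x) (frontier P))) > 0}"

definition M_set ::
    "'d::euclidean_space set \<Rightarrow> real ^ 'n ^ 'r \<Rightarrow> real ^ 'r \<Rightarrow> ('d \<Rightarrow> real ^ 'n) set" where
  "M_set \<Omega> W b = {\<eta> \<in> Linf \<Omega>. vec_le (W_integral \<Omega> W \<eta>) b}"

definition A_set ::
    "'d::euclidean_space set \<Rightarrow> (real ^ 'n) set \<Rightarrow> real ^ 'n ^ 'r \<Rightarrow> real ^ 'r \<Rightarrow>
     ('d \<Rightarrow> real ^ 'n) set" where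
  "A_set \<Omega> P W b = K_set \<Omega> P \<inter> M_set \<Omega> W b"

definition M1_set ::
    "'d::euclidean_space set \<Rightarrow> real ^ 'n ^ 'r \<Rightarrow> real ^ 'r \<Rightarrow> ('d \<Rightarrow> real ^ 'n) set" where
  "M1_set \<Omega> W b = {\<eta> \<in> L1 \<Omega>. vec_le (W_integral \<Omega> W \<eta>) b}"

section \<open>Differentiability of functionals on \<open>L\<^sup>\<infinity>\<close>\<close>

definition Linf_functional ::
    "'d::euclidean_space set \<Rightarrow> (('d \<Rightarrow> 'a::euclidean_space) \<Rightarrow> real) \<Rightarrow> bool" where
  "Linf_functional \<Omega> F \<longleftrightarrow>
     (\<forall>f\<in>Linf \<Omega>. \<forall>g\<in>Linf \<Omega>. (AE x in lebesgue_on \<Omega>. f x = g x) \<longrightarrow> F f = F g)"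

definition Linf_dual ::
    "'d::euclidean_space set \<Rightarrow> (('d \<Rightarrow> 'a::euclidean_space) \<Rightarrow> real) set" where
  "Linf_dual \<Omega> = {T.
     (\<forall>f\<in>Linf \<Omega>. \<forall>g\<in>Linf \<Omega>. T (\<lambda>x. f x + g x) = T f + T g) \<and>
     (\<forall>c. \<forall>f\<in>Linf \<Omega>. T (\<lambda>x. c *\<^sub>R f x) = c * T f) \<and>
     (\<exists>C. \<forall>f\<in>Linf \<Omega>. \<bar>T f\<bar> \<le> C * Linf_norm \<Omega> f)}"

definition has_frechet_derivative_Linf ::
    "'d::euclidean_space set \<Rightarrow> (('d \<Rightarrow> 'a::euclidean_space) \<Rightarrow> real) \<Rightarrow>
     (('d \<Rightarrow> 'a) \<Rightarrow> real) \<Rightarrow> ('d \<Rightarrow> 'a) \<Rightarrow> bool" where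
  "has_frechet_derivative_Linf \<Omega> F T \<eta> \<longleftrightarrow>
     T \<in> Linf_dual \<Omega> \<and>
     (\<forall>\<epsilon>>0. \<exists>\<delta>>0. \<forall>h\<in>Linf \<Omega>. Linf_norm \<Omega> h < \<delta> \<longrightarrow>
        \<bar>F (\<lambda>x. \<eta> x + h x) - F \<eta> - T h\<bar> \<le> \<epsilon> * Linf_norm \<Omega> h)"

text \<open>Norm continuity of \<open>F' : S \<rightarrow> (L\<^sup>\<infinity>)'\<close>: the last inequality says that the dual norm of
  \<open>F' \<zeta> - F' \<eta>\<close> is at most \<open>\<epsilon>\<close>.\<close>

definition continuous_into_dual ::
    "'d::euclidean_space set \<Rightarrow> ('d \<Rightarrow> 'a::euclidean_space) set \<Rightarrow>
     (('d \<Rightarrow> 'a) \<Rightarrow> ('d \<Rightarrow> 'a) \<Rightarrow> real) \<Rightarrow> bool" where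
  "continuous_into_dual \<Omega> S F' \<longleftrightarrow>
     (\<forall>\<eta>\<in>S. \<forall>\<epsilon>>0. \<exists>\<delta>>0. \<forall>\<zeta>\<in>S. Linf_norm \<Omega> (\<lambda>x. \<zeta> x - \<eta> x) < \<delta> \<longrightarrow>
        (\<forall>q\<in>Linf \<Omega>. \<bar>F' \<zeta> q - F' \<eta> q\<bar> \<le> \<epsilon> * Linf_norm \<Omega> q))"

definition represents_functional ::
    "'d::euclidean_space set \<Rightarrow> ('d \<Rightarrow> 'a::euclidean_space) \<Rightarrow> (('d \<Rightarrow> 'a) \<Rightarrow> real) \<Rightarrow> bool" where
  "represents_functional \<Omega> g T \<longleftrightarrow>
     g \<in> Linf \<Omega> \<and> (\<forall>q\<in>Linf \<Omega>. (\<integral>x. g x \<bullet> q x \<partial>(lebesgue_on \<Omega>)) = T q)"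

section \<open>The minimization problem\<close>

text \<open>Here \<open>g\<close> stands for the gradient of the functional at \<open>v\<close>.\<close>

definition objective ::
    "'d::euclidean_space set \<Rightarrow> ('a::euclidean_space \<Rightarrow> ereal) \<Rightarrow> real \<Rightarrow> ('d \<Rightarrow> 'a) \<Rightarrow>
     ('d \<Rightarrow> 'a) \<Rightarrow> ('d \<Rightarrow> 'a) \<Rightarrow> ereal" where
  "objective \<Omega> R \<alpha> g v \<eta> =
     ext_integral (lebesgue_on \<Omega>) (\<lambda>x. ereal (\<alpha> * (g x \<bullet> \<eta> x)) + bregman R (\<eta> x) (v x))"

definition is_minimizer :: "'f set \<Rightarrow> ('f \<Rightarrow> ereal) \<Rightarrow> 'f \<Rightarrow> bool" where
  "is_minimizer S J \<eta> \<longleftrightarrow> \<eta> \<in> S \<and> (\<forall>\<zeta>\<in>S. J \<eta> \<le> J \<zeta>)"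

definition is_unique_minimizer_ae ::
    "'d::euclidean_space set \<Rightarrow> ('d \<Rightarrow> 'a::euclidean_space) set \<Rightarrow> (('d \<Rightarrow> 'a) \<Rightarrow> ereal) \<Rightarrow>
     ('d \<Rightarrow> 'a) \<Rightarrow> bool" where
  "is_unique_minimizer_ae \<Omega> S J \<eta> \<longleftrightarrow>
     is_minimizer S J \<eta> \<and>
     (\<forall>\<zeta>. is_minimizer S J \<zeta> \<longrightarrow> (AE x in lebesgue_on \<Omega>. \<zeta> x = \<eta> x))"

end

theory Submission
  imports Defs "HOL-Real_Asymp.Real_Asymp"
begin

text \<open>The convex conjugate of \<open>R\<close> is the log-sum-exp function \<open>y \<mapsto> ln (\<Sum>\<^sub>v exp (v \<bullet> y))\<close> of the vertices,
  whose gradient sends \<open>y\<close> to the softmax average of the vertices, an interior point of \<open>P\<close>. Hence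
  for a fixed multiplier \<open>\<mu>\<close> of the integral constraint the Lagrangian is minimized pointwise by
  \<open>\<eta>(x) = \<nabla>R\<^sup>*(\<nabla>R(v(x)) - \<alpha> \<nabla>F(v)(x) - W\<^sup>T \<mu>)\<close>. The argument of \<open>\<nabla>R\<^sup>*\<close> is essentially bounded, so \<open>\<eta>\<close>
  stays uniformly inside \<open>P\<close>, and \<open>\<nabla>R(\<eta>)\<close> is that bounded argument. A multiplier satisfying the
  complementarity conditions is obtained from the finite-dimensional dual problem. A quantitative
  form of Gibbs' inequality gives quadratic growth of the integrand, hence uniqueness.\<close>

section \<open>Entropy and the log-sum-exp function of a finite set of points\<close>

text \<open>Apply \<open>ln t \<le> t - 1\<close> to \<open>t = sqrt s / sqrt a\<close> instead of
  \<open>s / a\<close>. Doubling the result leaves the squared difference of square roots as a gain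
  over the usual bound \<open>a - s\<close>.\<close>

lemma mult_ln_Bregman_ge:
  fixes a s :: real
  assumes "a \<ge> 0" "s > 0"
  shows "a * ln a - a * ln s \<ge> a - s + (sqrt a - sqrt s)\<^sup>2"
proof (cases "a = 0")
  case False
  with assms have a: "a > 0" by simp
  have "ln (sqrt s / sqrt a) \<le> sqrt s / sqrt a - 1"
    using a assms by (intro ln_le_minus_one) simp
  moreover have "2 * ln (sqrt s / sqrt a) = ln s - ln a"
    using a assms by (simp add: ln_div ln_sqrt)
  ultimately have "ln s - ln a \<le> 2 * (sqrt s / sqrt a) - 2"
    by linarith
  then have "a * (ln s - ln a) \<le> a * (2 * (sqrt s / sqrt a) - 2)"
    using a by (intro mult_left_mono) simp_all
  also have "\<dots> = 2 * (sqrt a * sqrt s) - 2 * a"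
    using a by (simp add: right_diff_distrib real_div_sqrt flip: times_divide_eq_left)
  finally show ?thesis
    using assms by (simp add: power2_eq_square algebra_simps)
qed (use assms in auto)

lemma continuous_on_mult_ln: "continuous_on {0..} (\<lambda>x::real. x * ln x)"
proof -
  have "continuous (at x within {0..}) (\<lambda>x::real. x * ln x)" if "x \<ge> 0" for x
  proof (cases "x = 0")
    case True
    have "((\<lambda>x::real. x * ln x) \<longlongrightarrow> 0) (at_right 0)" by real_asymp
    moreover have "at (0::real) within {0..} = at_right 0"
      by (rule at_within_nhd[where S = UNIV]) auto
    ultimately show ?thesis
      using True by (simp add: continuous_within)
  qed (use that in \<open>intro continuous_intros, auto\<close>)
  then show ?thesis by (simp add: continuous_on_eq_continuous_within)
qed

locale finite_point_set =
  fixes V :: "'a::euclidean_space set"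
  assumes finite_V [simp, intro]: "finite V" and V_nonempty: "V \<noteq> {}"
begin

definition partition_sum :: "'a \<Rightarrow> real" where
  "partition_sum y = (\<Sum>u\<in>V. exp (u \<bullet> y))"

definition lse :: "'a \<Rightarrow> real" where
  "lse y = ln (partition_sum y)"

definition softmax :: "'a \<Rightarrow> 'a \<Rightarrow> real" where
  "softmax y u = exp (u \<bullet> y) / partition_sum y"

definition softmean :: "'a \<Rightarrow> 'a" where
  "softmean y = (\<Sum>u\<in>V. softmax y u *\<^sub>R u)"

text \<open>The probability simplex over \<open>V\<close>. Values off \<open>V\<close> stay free, so
  as a set of total functions it is not compact; compactness arguments must first normalize those
  values.\<close>

definition weights :: "('a \<Rightarrow> real) set" where
  "weights = {l. (\<forall>u\<in>V. 0 \<le> l u) \<and> sum l V = 1}"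

definition neg_entropy :: "('a \<Rightarrow> real) \<Rightarrow> real" where
  "neg_entropy l = (\<Sum>u\<in>V. l u * ln (l u))"

definition barycenter :: "('a \<Rightarrow> real) \<Rightarrow> 'a" where
  "barycenter l = (\<Sum>u\<in>V. l u *\<^sub>R u)"

lemma softmean_eq_barycenter: "softmean y = barycenter (softmax y)"
  by (simp add: softmean_def barycenter_def)

lemma partition_sum_pos: "partition_sum y > 0"
  unfolding partition_sum_def using V_nonempty by (intro sum_pos) auto

lemma softmax_pos: "softmax y u > 0"
  by (simp add: softmax_def partition_sum_pos)

lemma sum_softmax: "sum (softmax y) V = 1"
  using partition_sum_pos[of y]
  by (simp add: softmax_def partition_sum_def flip: sum_divide_distrib)

lemma softmax_in_weights: "softmax y \<in> weights"
  by (simp add: weights_def sum_softmax softmax_pos less_imp_le)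

lemma ln_softmax: "ln (softmax y u) = u \<bullet> y - lse y"
  using partition_sum_pos[of y] by (simp add: softmax_def lse_def ln_div)

lemma continuous_on_partition_sum: "continuous_on S partition_sum"
  unfolding partition_sum_def by (intro continuous_intros)

lemma continuous_on_lse: "continuous_on S lse"
  unfolding lse_def using partition_sum_pos
  by (intro continuous_intros continuous_on_partition_sum) (auto simp: less_imp_neq[symmetric])

lemma continuous_on_softmax: "continuous_on S (\<lambda>y. softmax y u)"
  unfolding softmax_def using partition_sum_pos
  by (intro continuous_intros continuous_on_partition_sum) (auto simp: less_imp_neq[symmetric])

lemma continuous_on_softmean: "continuous_on S softmean"
  unfolding softmean_def by (intro continuous_intros continuous_on_softmax)

text \<open>The logarithm of a softmax weight is affine in the point \<open>u\<close>, so the cross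
  entropy sees \<open>l\<close> only through its barycenter. This turns entropy inequalities on
  weights into affine bounds on \<open>R\<close>.\<close>

lemma sum_mult_ln_softmax:
  assumes "sum l V = 1"
  shows "(\<Sum>u\<in>V. l u * ln (softmax y u)) = barycenter l \<bullet> y - lse y"
  using assms
  by (simp add: ln_softmax right_diff_distrib sum_subtractf barycenter_def inner_sum_left
      flip: sum_distrib_right)

lemma neg_entropy_softmax: "neg_entropy (softmax y) = softmean y \<bullet> y - lse y"
  by (simp add: neg_entropy_def sum_mult_ln_softmax sum_softmax softmean_eq_barycenter)

text \<open>Gibbs' inequality with a squared Hellinger remainder: sum the scalar estimate over
  \<open>V\<close>; the linear terms cancel because both weight vectors have total mass 1.\<close>

lemma neg_entropy_ge_Hellinger:
  assumes "l \<in> weights"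
  shows "barycenter l \<bullet> y - lse y + (\<Sum>u\<in>V. (sqrt (l u) - sqrt (softmax y u))\<^sup>2) \<le> neg_entropy l"
proof -
  have l: "\<And>u. u \<in> V \<Longrightarrow> 0 \<le> l u" "sum l V = 1"
    using assms by (auto simp: weights_def)
  have "(\<Sum>u\<in>V. l u - softmax y u + (sqrt (l u) - sqrt (softmax y u))\<^sup>2)
      \<le> (\<Sum>u\<in>V. l u * ln (l u) - l u * ln (softmax y u))"
    by (intro sum_mono mult_ln_Bregman_ge l softmax_pos)
  then show ?thesis
    by (simp add: sum.distrib sum_subtractf l sum_softmax sum_mult_ln_softmax neg_entropy_def)
qed

lemma neg_entropy_ge:
  assumes "l \<in> weights"
  shows "barycenter l \<bullet> y - lse y \<le> neg_entropy l"
  using neg_entropy_ge_Hellinger[OF assms, of y]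
    sum_nonneg[of V "\<lambda>u. (sqrt (l u) - sqrt (softmax y u))\<^sup>2"] by simp

text \<open>The gradient inequality of the convex function \<open>lse\<close>, obtained without
  differentiating: test the weights \<open>softmax z\<close> in Gibbs' inequality at
  \<open>y\<close>, where equality holds at \<open>z\<close>.\<close>

lemma lse_diff_le: "lse z - lse y \<le> softmean z \<bullet> (z - y)"
  using neg_entropy_ge[OF softmax_in_weights[of z], of y] neg_entropy_softmax[of z]
  by (simp add: softmean_eq_barycenter inner_diff_right)

text \<open>At a point of \<open>V\<close> a single exponential is below the whole sum; the
  half-space this defines is convex, so it contains the hull.\<close>

lemma inner_le_lse:
  assumes "p \<in> convex hull V"
  shows "p \<bullet> y \<le> lse y"
proof -
  have "V \<subseteq> {u. y \<bullet> u \<le> lse y}"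
  proof
    fix u assume "u \<in> V"
    then have "exp (u \<bullet> y) \<le> partition_sum y"
      unfolding partition_sum_def by (intro member_le_sum) auto
    then have "u \<bullet> y \<le> lse y"
      unfolding lse_def using partition_sum_pos by (simp add: ln_ge_iff)
    then show "u \<in> {u. y \<bullet> u \<le> lse y}" by (simp add: inner_commute)
  qed
  then have "convex hull V \<subseteq> {u. y \<bullet> u \<le> lse y}"
    by (intro hull_minimal convex_halfspace_le)
  with assms show ?thesis by (auto simp: inner_commute)
qed

text \<open>The Hellinger remainder controls the distance of barycenters: factor
  \<open>l u - softmax y u\<close> as a difference of squares of roots, bound the sum of the two
  roots by 2, and apply Cauchy-Schwarz over \<open>V\<close>.\<close>

lemma neg_entropy_ge_quadratic:
  obtains c where "c > 0"
    "\<And>l y. l \<in> weights \<Longrightarrow>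
       barycenter l \<bullet> y - lse y + c * (norm (barycenter l - softmean y))\<^sup>2 \<le> neg_entropy l"
proof -
  \<comment> \<open>The Cauchy-Schwarz factor is the sum of \<open>(2 * norm u)\<^sup>2\<close>;
    adding 1 keeps \<open>K\<close> positive even for \<open>V = {0}\<close>.\<close>
  define K where "K = 4 * (\<Sum>u\<in>V. (norm u)\<^sup>2) + 1"
  have K: "K > 0"
    unfolding K_def by (intro add_nonneg_pos mult_nonneg_nonneg sum_nonneg) auto
  have key: "(norm (barycenter l - softmean y))\<^sup>2 \<le> K * (\<Sum>u\<in>V. (sqrt (l u) - sqrt (softmax y u))\<^sup>2)"
    if "l \<in> weights" for l y
  proof -
    have l: "\<And>u. u \<in> V \<Longrightarrow> 0 \<le> l u" "sum l V = 1"
      using that by (auto simp: weights_def)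
    have le1: "m u \<le> 1" if "m \<in> weights" "u \<in> V" for m u
      using that member_le_sum[of u V m] by (auto simp: weights_def)
    have *: "norm ((l u - softmax y u) *\<^sub>R u) \<le> \<bar>sqrt (l u) - sqrt (softmax y u)\<bar> * (2 * norm u)"
      if "u \<in> V" for u
    proof -
      have "sqrt (l u) \<le> 1" "sqrt (softmax y u) \<le> 1"
        using le1 that \<open>l \<in> weights\<close> softmax_in_weights by simp_all
      moreover have "0 \<le> sqrt (l u)" "0 \<le> sqrt (softmax y u)"
        using l(1)[OF that] softmax_pos[of y u] by simp_all
      ultimately have le2: "\<bar>sqrt (l u) + sqrt (softmax y u)\<bar> \<le> 2"
        by linarith
      have "l u - softmax y u = (sqrt (l u) - sqrt (softmax y u)) * (sqrt (l u) + sqrt (softmax y u))"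
        using l(1)[OF that] softmax_pos[of y u] by (simp add: algebra_simps)
      then have "\<bar>l u - softmax y u\<bar> = \<bar>sqrt (l u) - sqrt (softmax y u)\<bar> * \<bar>sqrt (l u) + sqrt (softmax y u)\<bar>"
        by (simp only: abs_mult)
      also have "\<dots> \<le> \<bar>sqrt (l u) - sqrt (softmax y u)\<bar> * 2"
        by (intro mult_left_mono le2) simp
      finally show ?thesis by (simp add: mult_right_mono mult.assoc flip: mult.assoc)
    qed
    have "barycenter l - softmean y = (\<Sum>u\<in>V. (l u - softmax y u) *\<^sub>R u)"
      by (simp add: barycenter_def softmean_def scaleR_diff_left sum_subtractf)
    then have "norm (barycenter l - softmean y) \<le> (\<Sum>u\<in>V. \<bar>sqrt (l u) - sqrt (softmax y u)\<bar> * (2 * norm u))"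
      using sum_norm_le[of V, OF *] by simp
    then have "(norm (barycenter l - softmean y))\<^sup>2
        \<le> (\<Sum>u\<in>V. \<bar>sqrt (l u) - sqrt (softmax y u)\<bar> * (2 * norm u))\<^sup>2"
      by (intro power_mono) auto
    also have "\<dots> \<le> (\<Sum>u\<in>V. \<bar>sqrt (l u) - sqrt (softmax y u)\<bar>\<^sup>2) * (\<Sum>u\<in>V. (2 * norm u)\<^sup>2)"
      by (rule Cauchy_Schwarz_ineq_sum)
    also have "\<dots> \<le> (\<Sum>u\<in>V. (sqrt (l u) - sqrt (softmax y u))\<^sup>2) * K"
      by (intro mult_mono) (auto intro: sum_nonneg simp: K_def power_mult_distrib simp flip: sum_distrib_left)
    finally show ?thesis by (simp add: mult.commute)
  qed
  show ?thesis
  proof (rule that[of "1 / K"])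
    fix l y assume l: "l \<in> weights"
    have "1 / K * (norm (barycenter l - softmean y))\<^sup>2 \<le> (\<Sum>u\<in>V. (sqrt (l u) - sqrt (softmax y u))\<^sup>2)"
      using key[OF l, of y] K by (simp add: field_simps)
    with neg_entropy_ge_Hellinger[OF l, of y]
    show "barycenter l \<bullet> y - lse y + 1 / K * (norm (barycenter l - softmean y))\<^sup>2 \<le> neg_entropy l"
      by simp
  qed (use K in simp)
qed

end

text \<open>The error of \<open>f\<close> against the affine minorant lies between 0 and the error
  of \<open>U\<close>, which is of smaller order than \<open>norm (y - x)\<close>.\<close>

lemma has_derivative_squeeze_affine:
  fixes f U :: "'a::real_normed_vector \<Rightarrow> real"
  assumes U: "(U has_derivative D) (at x)" and "U x = f x"
    and le: "\<forall>\<^sub>F y in at x. f x + D (y - x) \<le> f y \<and> f y \<le> U y"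
  shows "(f has_derivative D) (at x)"
proof -
  have "((\<lambda>y. norm (U y - U x - D (y - x)) / norm (y - x)) \<longlongrightarrow> 0) (at x)"
    using U by (simp add: has_derivative_iff_norm)
  then have "((\<lambda>y. norm (f y - f x - D (y - x)) / norm (y - x)) \<longlongrightarrow> 0) (at x)"
  proof (rule Lim_null_comparison[rotated])
    show "\<forall>\<^sub>F y in at x. norm (norm (f y - f x - D (y - x)) / norm (y - x))
        \<le> norm (U y - U x - D (y - x)) / norm (y - x)"
      using le by eventually_elim (auto intro!: divide_right_mono simp: \<open>U x = f x\<close>)
  qed
  with U show ?thesis by (simp add: has_derivative_iff_norm)
qed

lemma gradient_eqI:
  assumes "((\<lambda>y. real_of_ereal (R y)) has_derivative (\<lambda>h. h \<bullet> D)) (at x)"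
  shows "gradient R x = D"
  unfolding gradient_def gderiv_def
proof (rule the_equality)
  fix D' assume "((\<lambda>y. real_of_ereal (R y)) has_derivative (\<lambda>h. h \<bullet> D')) (at x)"
  from has_derivative_unique[OF this assms] have "h \<bullet> D' = h \<bullet> D" for h
    by (simp add: fun_eq_iff)
  then show "D' = D" by (metis vector_eq_ldot)
qed (rule assms)

section \<open>The polytopal Legendre function\<close>

locale solid_polytope =
  fixes P :: "'a::euclidean_space set"
  assumes polytope: "polytope P" and interior_nonempty: "interior P \<noteq> {}"
begin

abbreviation V :: "'a set" where
  "V \<equiv> {v. v extreme_point_of P}"

lemma convex_hull_V: "convex hull V = P"
  using polytope by (metis Krein_Milman_Minkowski polytope_imp_compact polytope_imp_convex)

sublocale finite_point_set V
proof
  show "finite V"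
    by (simp add: finite_polyhedron_extreme_points polytope polytope_imp_polyhedron)
  show "V \<noteq> {}"
    using convex_hull_V interior_nonempty by (metis convex_hull_empty interior_empty)
qed

abbreviation R :: "'a \<Rightarrow> ereal" where
  "R \<equiv> polytopal_legendre P"

lemma R_eq: "R x = Inf {ereal (neg_entropy l) | l. l \<in> weights \<and> barycenter l = x}"
  unfolding polytopal_legendre_def neg_entropy_def weights_def barycenter_def Let_def
  by (rule arg_cong[where f = Inf]) auto

lemma R_le: "l \<in> weights \<Longrightarrow> R (barycenter l) \<le> ereal (neg_entropy l)"
  unfolding R_eq by (intro Inf_lower) auto

lemma R_ge:
  assumes "\<And>l. l \<in> weights \<Longrightarrow> barycenter l = x \<Longrightarrow> c \<le> neg_entropy l"
  shows "ereal c \<le> R x"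
  unfolding R_eq using assms by (intro Inf_greatest) auto

lemma R_ge_affine: "ereal (x \<bullet> y - lse y) \<le> R x"
  using neg_entropy_ge by (intro R_ge) auto

text \<open>The constant does not depend on \<open>y\<close>. The integrated estimate relies on
  this, since the dual point there varies over the domain.\<close>

lemma R_ge_quadratic:
  obtains c where "c > 0" "\<And>x y. ereal (x \<bullet> y - lse y + c * (norm (x - softmean y))\<^sup>2) \<le> R x"
proof -
  obtain c where "c > 0" and c: "\<And>l y. l \<in> weights \<Longrightarrow>
       barycenter l \<bullet> y - lse y + c * (norm (barycenter l - softmean y))\<^sup>2 \<le> neg_entropy l"
    using neg_entropy_ge_quadratic by metis
  show ?thesis
    by (rule that[OF \<open>c > 0\<close>], rule R_ge) (use c in blast)
qed

text \<open>The softmax weights attain the infimum, because they give equality in Gibbs' inequality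
  at \<open>y\<close>.\<close>

lemma R_softmean: "R (softmean y) = ereal (softmean y \<bullet> y - lse y)"
  using R_le[OF softmax_in_weights[of y]] R_ge_affine[of "softmean y" y]
  by (simp add: neg_entropy_softmax flip: softmean_eq_barycenter)

lemma barycenter_in_P:
  assumes "l \<in> weights"
  shows "barycenter l \<in> P"
proof -
  have "barycenter l \<in> convex hull V"
    unfolding barycenter_def using assms
    by (intro convex_sum[OF finite_V convex_convex_hull]) (auto simp: weights_def intro: hull_inc)
  then show ?thesis by (simp only: convex_hull_V)
qed

lemma P_weights:
  assumes "x \<in> P"
  obtains l where "l \<in> weights" "barycenter l = x"
proof -
  have "x \<in> convex hull V" using assms by (simp only: convex_hull_V)
  then show ?thesis
    using that by (auto simp: convex_hull_finite weights_def barycenter_def)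
qed

lemma neg_entropy_nonpos:
  assumes "l \<in> weights"
  shows "neg_entropy l \<le> 0"
  unfolding neg_entropy_def
proof (rule sum_nonpos)
  fix u assume u: "u \<in> V"
  have l: "\<And>u. u \<in> V \<Longrightarrow> 0 \<le> l u" "sum l V = 1"
    using assms by (auto simp: weights_def)
  have "0 \<le> l u" "l u \<le> 1"
    using u l(1) member_le_sum[of u V l] by (simp_all add: l(2))
  then show "l u * ln (l u) \<le> 0"
    by (cases "l u = 0") (auto simp: mult_le_0_iff)
qed

lemma R_bounds:
  assumes "x \<in> P"
  shows "ereal (- lse 0) \<le> R x" "R x \<le> 0"
proof -
  show "ereal (- lse 0) \<le> R x" using R_ge_affine[of x 0] by simp
  obtain l where l: "l \<in> weights" "barycenter l = x" using P_weights[OF assms] .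
  with R_le[OF l(1)] neg_entropy_nonpos[OF l(1)] show "R x \<le> 0"
    by (metis order_trans ereal_less_eq(3) zero_ereal_def)
qed

text \<open>Lower semicontinuity: each real sublevel set is the continuous image of a compact
  sublevel set of the entropy on the simplex, hence closed.\<close>

lemma borel_measurable_R [measurable]: "R \<in> borel_measurable borel"
proof (rule borel_measurableI_le)
  \<comment> \<open>A compact copy of the simplex: forcing the value 0 off \<open>V\<close> makes it
    a closed part of a product of compact sets, so Tychonoff applies.\<close>
  define C where "C = PiE UNIV (\<lambda>u. if u \<in> V then {0..1::real} else {0}) \<inter> {l. sum l V = 1}"
  have C: "compact C" unfolding C_def
  proof (rule compact_Int_closed)
    have "compactin (product_topology (\<lambda>_. euclideanreal) UNIV)
        (PiE UNIV (\<lambda>u. if u \<in> V then {0..1::real} else {0}))"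
      unfolding compactin_PiE by auto
    then show "compact (PiE UNIV (\<lambda>u. if u \<in> V then {0..1::real} else {0}))"
      by (simp add: euclidean_product_topology flip: compactin_euclidean_iff)
    show "closed {l::'a \<Rightarrow> real. sum l V = 1}"
      by (intro closed_Collect_eq continuous_intros) auto
  qed
  have "closed C"
  proof -
    have "closed ((\<lambda>l::'a \<Rightarrow> real. l u) -` (if u \<in> V then {0..1} else {0}))" for u
      by (intro closed_vimage continuous_on_product_coordinates) simp
    then have "closed (\<Inter>u. (\<lambda>l::'a \<Rightarrow> real. l u) -` (if u \<in> V then {0..1} else {0}))"
      by (intro closed_INT) blast
    also have "(\<Inter>u. (\<lambda>l::'a \<Rightarrow> real. l u) -` (if u \<in> V then {0..1} else {0}))
        = PiE UNIV (\<lambda>u. if u \<in> V then {0..1} else {0})"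
      by (auto simp: PiE_iff)
    finally show ?thesis
      unfolding C_def by (intro closed_Int closed_Collect_eq continuous_intros) auto
  qed
  have C_weights: "l \<in> weights" if "l \<in> C" for l
    using that by (auto simp: C_def weights_def PiE_iff split: if_splits)
  have weights_C: "\<exists>m\<in>C. barycenter m = barycenter l \<and> neg_entropy m = neg_entropy l"
    if "l \<in> weights" for l
  proof -
    have l: "\<And>u. u \<in> V \<Longrightarrow> 0 \<le> l u" "sum l V = 1"
      using that by (auto simp: weights_def)
    have "l u \<le> 1" if "u \<in> V" for u
      using that l(1) member_le_sum[of u V l] by (simp add: l(2))
    with l show ?thesis
      by (intro bexI[of _ "\<lambda>u. if u \<in> V then l u else 0"])
         (auto simp: C_def barycenter_def neg_entropy_def)
  qed
  have continuous_on_coord: "continuous_on C (\<lambda>l. l u)" for u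
    by (rule continuous_on_subset[OF continuous_on_product_coordinates]) simp
  have cont_bary: "continuous_on C barycenter"
    unfolding barycenter_def by (intro continuous_intros continuous_on_coord)
  have cont_ent: "continuous_on C neg_entropy"
    unfolding neg_entropy_def
  proof (rule continuous_on_sum)
    fix u assume "u \<in> V"
    then have "(\<lambda>l. l u) ` C \<subseteq> {0..}" using C_weights by (auto simp: weights_def)
    from continuous_on_compose2[OF continuous_on_mult_ln _ this]
    show "continuous_on C (\<lambda>l. l u * ln (l u))" by (auto intro: continuous_on_coord)
  qed
  fix c :: ereal
  \<comment> \<open>The inclusion from left to right needs the infimum to be attained, which
    compactness of the fibre \<open>D\<close> over \<open>x\<close> provides.\<close>
  have sub: "{x. R x \<le> ereal c} = barycenter ` {l \<in> C. neg_entropy l \<le> c}" for c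
  proof safe
    fix x assume x: "R x \<le> ereal c"
    define D where "D = {l \<in> C. barycenter l = x}"
    have "closed D"
      using continuous_closed_preimage[OF cont_bary \<open>closed C\<close> closed_singleton[of x]]
      by (rule back_subst[of closed]) (auto simp: D_def)
    then have "compact (C \<inter> D)"
      by (rule compact_Int_closed[OF C])
    also have "C \<inter> D = D"
      by (auto simp: D_def)
    finally have "compact D" .
    \<comment> \<open>An empty fibre would make \<open>R x\<close> the infimum of the empty set,
      which is \<infinity>.\<close>
    moreover have "D \<noteq> {}"
    proof
      assume "D = {}"
      then have "{ereal (neg_entropy l) | l. l \<in> weights \<and> barycenter l = x} = {}"
        using weights_C by (fastforce simp: D_def)
      then have "R x = Inf {}" by (simp only: R_eq)
      then have "R x = \<infinity>" by (simp add: top_ereal_def)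
      with x show False by simp
    qed
    moreover have "continuous_on D neg_entropy"
      using cont_ent by (rule continuous_on_subset) (auto simp: D_def)
    ultimately obtain l where l: "l \<in> D" "\<And>m. m \<in> D \<Longrightarrow> neg_entropy l \<le> neg_entropy m"
      using continuous_attains_inf by metis
    have "ereal (neg_entropy l) \<le> R x"
      using weights_C l(2) by (intro R_ge) (fastforce simp: D_def)
    with x have "neg_entropy l \<le> c" by (metis order_trans ereal_less_eq(3))
    with l(1) show "x \<in> barycenter ` {l \<in> C. neg_entropy l \<le> c}"
      by (auto simp: D_def)
  next
    fix l assume "l \<in> C" "neg_entropy l \<le> c"
    with R_le[OF C_weights] show "R (barycenter l) \<le> ereal c"
      by (metis order_trans ereal_less_eq(3))
  qed
  have closed_sub: "closed {x. R x \<le> ereal c}" for c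
  proof -
    have "{l \<in> C. neg_entropy l \<le> c} = C \<inter> (C \<inter> neg_entropy -` {..c})"
      by auto
    also have "compact \<dots>"
      using continuous_closed_preimage[OF cont_ent \<open>closed C\<close>] by (intro compact_Int_closed[OF C]) simp
    finally have "compact {l \<in> C. neg_entropy l \<le> c}" .
    then show ?thesis
      unfolding sub by (intro compact_imp_closed compact_continuous_image)
        (auto intro: continuous_on_subset[OF cont_bary])
  qed
  show "{x \<in> space borel. R x \<le> c} \<in> sets borel"
  proof (cases c)
    case MInf
    have "R x \<noteq> - \<infinity>" for x
      using R_ge_affine[of x 0] by auto
    with MInf show ?thesis by simp
  qed (use closed_sub in auto)
qed

text \<open>A linear right inverse of \<open>barycenter\<close> into weight changes of total mass 0.
  An interior point \<open>x\<close> and its shifts \<open>x + e *\<^sub>R b\<close> both have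
  weights; their difference quotient lifts the basis vector \<open>b\<close>, and the lift extends
  linearly.\<close>

lemma exists_linear_lift:
  obtains L where "\<And>u. linear (\<lambda>d. L d u)" "\<And>d. sum (L d) V = 0" "\<And>d. barycenter (L d) = d"
proof -
  obtain x where "x \<in> interior P" using interior_nonempty by blast
  then obtain e where e: "e > 0" "cball x e \<subseteq> P"
    by (auto simp: mem_interior_cball)
  have "\<exists>a. sum a V = 0 \<and> barycenter a = b" if b: "b \<in> Basis" for b
  proof -
    have "x \<in> P" "x + e *\<^sub>R b \<in> P"
      using e b by (auto simp: subset_iff dist_norm)
    then obtain k l where kl: "k \<in> weights" "barycenter k = x" "l \<in> weights" "barycenter l = x + e *\<^sub>R b"
      using P_weights by metis
    have "barycenter (\<lambda>u. (l u - k u) / e) = (1 / e) *\<^sub>R (barycenter l - barycenter k)"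
      by (simp add: barycenter_def scaleR_sum_right scaleR_right_diff_distrib scaleR_diff_left
          diff_divide_distrib sum_subtractf)
    moreover have "sum (\<lambda>u. (l u - k u) / e) V = 0"
      using kl by (simp add: weights_def sum_subtractf flip: sum_divide_distrib)
    ultimately show ?thesis
      using kl e by (intro exI[of _ "\<lambda>u. (l u - k u) / e"]) simp
  qed
  then obtain a where a: "\<And>b. b \<in> Basis \<Longrightarrow> sum (a b) V = 0"
      "\<And>b. b \<in> Basis \<Longrightarrow> barycenter (a b) = b"
    by metis
  show ?thesis
  proof (rule that[of "\<lambda>d u. \<Sum>b\<in>Basis. (d \<bullet> b) * a b u"])
    show "linear (\<lambda>d. \<Sum>b\<in>Basis. (d \<bullet> b) * a b u)" for u
      by (rule linearI) (auto simp: inner_add_left sum.distrib sum_distrib_left algebra_simps)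
    show "(\<Sum>u\<in>V. \<Sum>b\<in>Basis. (d \<bullet> b) * a b u) = 0" for d
      by (subst sum.swap) (simp add: a flip: sum_distrib_left)
    have "barycenter (\<lambda>u. \<Sum>b\<in>Basis. (d \<bullet> b) * a b u) = (\<Sum>b\<in>Basis. (d \<bullet> b) *\<^sub>R barycenter (a b))" for d
      unfolding barycenter_def scaleR_sum_left scaleR_sum_right
      by (subst sum.swap) simp
    then show "barycenter (\<lambda>u. \<Sum>b\<in>Basis. (d \<bullet> b) * a b u) = d" for d
      by (simp add: a euclidean_representation)
  qed
qed

text \<open>Perturbing the softmax weights linearly along a lift of the displacement bounds \<open>R\<close> from above
  by a smooth function that is tangent to the affine lower bound given by Gibbs' inequality.\<close>

lemma softmean_interior_derivative:
  shows softmean_interior: "softmean y \<in> interior P"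
    and has_derivative_R: "((\<lambda>x. real_of_ereal (R x)) has_derivative (\<lambda>h. h \<bullet> y)) (at (softmean y))"
proof -
  obtain L where L: "\<And>u. linear (\<lambda>d. L d u)" "\<And>d. sum (L d) V = 0" "\<And>d. barycenter (L d) = d"
    by (rule exists_linear_lift) blast
  define s where "s = softmax y"
  define p where "p = softmean y"
  define w where "w x u = s u + L (x - p) u" for x u
  have s: "s u > 0" for u by (simp add: s_def softmax_pos)
  have L_bl: "bounded_linear (\<lambda>d. L d u)" for u
    using L(1) by (simp add: linear_conv_bounded_linear)
  have w_deriv: "((\<lambda>x. w x u) has_derivative (\<lambda>d. L d u)) (at x)" for u x
    unfolding w_def
    by (rule has_derivative_eq_rhs, (rule derivative_intros bounded_linear.has_derivative[OF L_bl])+) simp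
  have L0: "L 0 u = 0" for u
    using linear_0[OF L(1)[of u]] .
  have w_p: "w p u = s u" for u
    by (simp add: w_def L0)
  \<comment> \<open>All softmax weights are strictly positive, so small perturbations of zero total
    mass stay in the simplex.\<close>
  have ev: "\<forall>\<^sub>F x in nhds p. w x \<in> weights"
  proof -
    have "\<forall>\<^sub>F x in nhds p. \<forall>u\<in>V. 0 < w x u"
    proof (intro eventually_ball_finite ballI finite_V)
      fix u
      have "isCont (\<lambda>x. w x u) p" using w_deriv has_derivative_continuous by blast
      then have "((\<lambda>x. w x u) \<longlongrightarrow> w p u) (nhds p)"
        unfolding isCont_def tendsto_at_iff_tendsto_nhds[of "\<lambda>x. w x u" p] .
      then show "\<forall>\<^sub>F x in nhds p. 0 < w x u"
        by (rule order_tendstoD(1)) (simp add: w_p s)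
    qed
    then show ?thesis
      by eventually_elim (auto simp: weights_def w_def sum.distrib L(2) s_def sum_softmax less_imp_le)
  qed
  have bary_w: "barycenter (w x) = x" for x
  proof -
    have "barycenter (w x) = barycenter s + barycenter (L (x - p))"
      by (simp add: barycenter_def w_def scaleR_add_left sum.distrib)
    then show ?thesis by (simp add: L(3) s_def p_def softmean_eq_barycenter)
  qed
  \<comment> \<open>Every point near \<open>p\<close> is now a barycenter of admissible weights, so
    interiority comes for free.\<close>
  from ev have evP: "\<forall>\<^sub>F x in nhds p. x \<in> P"
    by eventually_elim (metis bary_w barycenter_in_P)
  then show "softmean y \<in> interior P"
    unfolding p_def eventually_nhds interior_def by blast
  have "((\<lambda>x. neg_entropy (w x)) has_derivative (\<lambda>d. \<Sum>u\<in>V. L d u * (ln (s u) + 1))) (at p)"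
    unfolding neg_entropy_def
  proof (rule has_derivative_sum)
    fix u
    have "((\<lambda>t. t * ln t) has_field_derivative (ln (s u) + 1)) (at (w p u))"
      using s[of u] by (auto intro!: derivative_eq_intros simp: w_p)
    then have "((\<lambda>t. t * ln t) has_derivative (\<lambda>h. h * (ln (s u) + 1))) (at (w p u))"
      unfolding has_field_derivative_def by (rule has_derivative_eq_rhs) (simp add: fun_eq_iff)
    from has_derivative_compose[OF w_deriv this]
    show "((\<lambda>x. w x u * ln (w x u)) has_derivative (\<lambda>d. L d u * (ln (s u) + 1))) (at p)" .
  qed
  \<comment> \<open>By \<open>ln_softmax\<close> the factor is \<open>u \<bullet> y\<close> plus a
    constant; the constant disappears since \<open>L d\<close> has total mass 0.\<close>
  moreover have "(\<Sum>u\<in>V. L d u * (ln (s u) + 1)) = d \<bullet> y" for d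
  proof -
    have "(\<Sum>u\<in>V. L d u * (ln (s u) + 1)) = barycenter (L d) \<bullet> y + (1 - lse y) * sum (L d) V"
      by (simp add: s_def ln_softmax barycenter_def inner_sum_left sum.distrib sum_distrib_left
          sum_subtractf algebra_simps)
    then show ?thesis by (simp add: L)
  qed
  ultimately have U: "((\<lambda>x. neg_entropy (w x)) has_derivative (\<lambda>d. d \<bullet> y)) (at p)"
    by simp
  have Rp: "R p = ereal (p \<bullet> y - lse y)" by (simp add: p_def R_softmean)
  have "((\<lambda>x. real_of_ereal (R x)) has_derivative (\<lambda>h. h \<bullet> y)) (at p)"
  proof (rule has_derivative_squeeze_affine[OF U])
    have "w p = s" by (simp add: fun_eq_iff w_p)
    then show "neg_entropy (w p) = real_of_ereal (R p)"
      by (simp add: R_softmean s_def neg_entropy_softmax p_def)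
    have "\<forall>\<^sub>F x in at p. w x \<in> weights"
      using ev by (rule filter_leD[OF at_within_le_nhds])
    then show "\<forall>\<^sub>F x in at p. real_of_ereal (R p) + (x - p) \<bullet> y \<le> real_of_ereal (R x) \<and>
        real_of_ereal (R x) \<le> neg_entropy (w x)"
    proof eventually_elim
      case (elim x)
      from R_le[OF elim] R_ge_affine[of x y] show ?case
        by (cases "R x") (auto simp: bary_w Rp inner_diff_left)
    qed
  qed
  then show "((\<lambda>x. real_of_ereal (R x)) has_derivative (\<lambda>h. h \<bullet> y)) (at (softmean y))"
    by (simp add: p_def)
qed

lemma gradient_R_softmean: "gradient R (softmean y) = y"
  by (rule gradient_eqI) (rule has_derivative_R)

lemma softmean_in_P: "softmean y \<in> P"
  using softmean_interior interior_subset by blast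

text \<open>The image of a closed ball under \<open>softmean\<close> is compact and lies in the
  interior, so it has positive distance from the closed frontier.\<close>

lemma infdist_softmean_frontier:
  obtains e where "e > 0" "\<And>y. norm y \<le> B \<Longrightarrow> e \<le> infdist (softmean y) (frontier P)"
proof -
  have "compact (softmean ` cball 0 B)"
    by (intro compact_continuous_image continuous_on_softmean compact_cball)
  moreover have "softmean ` cball 0 B \<inter> frontier P = {}"
    using softmean_interior by (auto simp: frontier_def)
  ultimately obtain e where e: "e > 0"
      "\<And>x z. x \<in> softmean ` cball 0 B \<Longrightarrow> z \<in> frontier P \<Longrightarrow> e \<le> dist x z"
    using separate_compact_closed[of "softmean ` cball 0 B" "frontier P"] by auto
  \<comment> \<open>The frontier must be shown non-empty because \<open>infdist\<close> to the empty
    set is 0 by convention.\<close>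
  have "P \<noteq> UNIV"
    using polytope_imp_bounded[OF polytope] not_bounded_UNIV by metis
  then have "frontier P \<noteq> {}"
    using interior_nonempty interior_empty by (metis frontier_eq_empty)
  then show ?thesis
    using e by (intro that[of e]) (auto simp: infdist_notempty intro!: cINF_greatest)
qed

end

section \<open>Lagrange multipliers\<close>

lemma continuous_bounded_on_cball:
  fixes f :: "'a::euclidean_space \<Rightarrow> 'b::real_normed_vector"
  assumes "continuous_on UNIV f"
  obtains K where "\<And>w. norm w \<le> r \<Longrightarrow> norm (f w) \<le> K"
proof -
  have "compact (f ` cball 0 r)"
    by (intro compact_continuous_image continuous_on_subset[OF assms] compact_cball) auto
  then obtain K where "\<forall>w\<in>f ` cball 0 r. norm w \<le> K"
    using compact_imp_bounded bounded_iff by metis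
  then show ?thesis by (intro that[of K]) simp
qed

lemma integrable_continuous_translate:
  fixes f :: "'a::euclidean_space \<Rightarrow> 'b::euclidean_space"
  assumes "finite_measure M" and [measurable]: "y \<in> borel_measurable M"
    and y: "AE x in M. norm (y x) \<le> B" and f: "continuous_on UNIV f"
  shows "integrable M (\<lambda>x. f (y x + z))"
proof -
  interpret finite_measure M by fact
  have [measurable]: "f \<in> borel_measurable borel"
    using f by (rule borel_measurable_continuous_onI)
  obtain K where K: "\<And>w. norm w \<le> B + norm z \<Longrightarrow> norm (f w) \<le> K"
    using continuous_bounded_on_cball[OF f] by blast
  have "AE x in M. norm (f (y x + z)) \<le> K"
    using y by eventually_elim (intro K norm_triangle_le, simp)
  then show ?thesis
    by (rule integrable_const_bound) measurable
qed

text \<open>Dominated convergence: along a convergent sequence of shifts the arguments stay, almost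
  everywhere, in one ball on which \<open>f\<close> is bounded.\<close>

lemma continuous_on_integral_translate:
  fixes f :: "'a::euclidean_space \<Rightarrow> 'b::euclidean_space"
  assumes [measurable]: "y \<in> borel_measurable M" and M: "finite_measure M"
    and y: "AE x in M. norm (y x) \<le> B" and f: "continuous_on UNIV f"
  shows "continuous_on UNIV (\<lambda>z. \<integral>x. f (y x + z) \<partial>M)"
proof -
  interpret finite_measure M by fact
  have [measurable]: "f \<in> borel_measurable borel"
    using f by (rule borel_measurable_continuous_onI)
  have "(\<lambda>n. \<integral>x. f (y x + X n) \<partial>M) \<longlonglongrightarrow> (\<integral>x. f (y x + z) \<partial>M)" if X: "X \<longlonglongrightarrow> z" for X z
  proof -
    have "bounded (range X)" using X by (rule convergent_imp_bounded)
    then obtain C where C: "\<And>n. norm (X n) \<le> C"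
      unfolding bounded_iff by blast
    obtain K where K: "\<And>w. norm w \<le> B + C \<Longrightarrow> norm (f w) \<le> K"
      using continuous_bounded_on_cball[OF f] by blast
    show ?thesis
    proof (rule integral_dominated_convergence[where w = "\<lambda>_. K"])
      show "AE x in M. (\<lambda>n. f (y x + X n)) \<longlonglongrightarrow> f (y x + z)"
      proof (rule AE_I2)
        fix x
        have "(\<lambda>n. y x + X n) \<longlonglongrightarrow> y x + z" by (intro tendsto_intros X)
        from continuous_on_tendsto_compose[OF f this]
        show "(\<lambda>n. f (y x + X n)) \<longlonglongrightarrow> f (y x + z)" by simp
      qed
      show "AE x in M. norm (f (y x + X n)) \<le> K" for n
        using y
      proof eventually_elim
        case (elim x)
        with C[of n] show ?case by (intro K norm_triangle_le) simp
      qed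
      show "(\<lambda>x. f (y x + z)) \<in> borel_measurable M" by measurable
      show "(\<lambda>x. f (y x + X n)) \<in> borel_measurable M" for n by measurable
    qed simp
  qed
  then have "isCont (\<lambda>z. \<integral>x. f (y x + z) \<partial>M) z" for z
    unfolding continuous_at_sequentially o_def by blast
  then show ?thesis
    by (simp add: continuous_on_eq_continuous_at)
qed

text \<open>The multiplier minimizes the dual objective \<open>\<mu> \<mapsto> \<integral> lse (y - A\<^sup>* \<mu>) + \<mu> \<bullet> b\<close> over the
  nonnegative orthant; strict feasibility of \<open>\<eta>\<close> makes that objective coercive there.\<close>

lemma (in finite_point_set) exists_multiplier:
  fixes A :: "'a \<Rightarrow> real ^ 'r" and y \<eta> :: "'x \<Rightarrow> 'a"
  assumes M: "finite_measure M" and A: "linear A"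
    and y [measurable]: "y \<in> borel_measurable M" and y_bound: "AE x in M. norm (y x) \<le> B"
    and \<eta> [measurable]: "\<eta> \<in> borel_measurable M" and \<eta>_hull: "AE x in M. \<eta> x \<in> convex hull V"
    and slater: "\<And>j. (\<integral>x. A (\<eta> x) \<partial>M) $ j < b $ j"
  obtains \<mu> where "\<And>j. 0 \<le> \<mu> $ j"
    "\<And>j. (\<integral>x. A (softmean (y x - adjoint A \<mu>)) \<partial>M) $ j \<le> b $ j"
    "\<mu> \<bullet> (\<integral>x. A (softmean (y x - adjoint A \<mu>)) \<partial>M) = \<mu> \<bullet> b"
proof -
  interpret finite_measure M by fact

  \<comment> \<open>Dual objective and its convexity\<close>
  define \<Phi> where "\<Phi> \<mu> = (\<integral>x. lse (y x - adjoint A \<mu>) \<partial>M) + \<mu> \<bullet> b" for \<mu>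
  \<comment> \<open>\<open>b - G \<mu>\<close> is the formal gradient of \<open>\<Phi>\<close> at
    \<open>\<mu>\<close>.\<close>
  define G where "G \<mu> = (\<integral>x. A (softmean (y x - adjoint A \<mu>)) \<partial>M)" for \<mu>
  have A_bl: "bounded_linear A" using A by (simp add: linear_conv_bounded_linear)
  have cont_A: "continuous_on S A" for S by (intro linear_continuous_on A_bl)
  have adj: "linear (adjoint A)" by (rule adjoint_linear[OF A])
  then have cont_adj: "continuous_on S (adjoint A)" for S
    by (intro linear_continuous_on) (simp add: linear_conv_bounded_linear)
  note transl = integrable_continuous_translate[OF M y y_bound]
    continuous_on_compose2[OF continuous_on_integral_translate[OF y M y_bound]]
  have int_lse: "integrable M (\<lambda>x. lse (y x - adjoint A \<mu>))" for \<mu>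
    using transl(1)[OF continuous_on_lse, of "- adjoint A \<mu>"] by simp
  have cont_ASM: "continuous_on UNIV (\<lambda>z. A (softmean z))"
    by (intro continuous_on_compose2[OF cont_A continuous_on_softmean]) auto
  have int_softmean: "integrable M (\<lambda>x. softmean (y x - adjoint A \<mu>))" for \<mu>
    using transl(1)[OF continuous_on_softmean, of "- adjoint A \<mu>"] by simp
  have int_ASM: "integrable M (\<lambda>x. A (softmean (y x - adjoint A \<mu>)))" for \<mu>
    using transl(1)[OF cont_ASM, of "- adjoint A \<mu>"] by simp
  have cont_\<Phi>: "continuous_on UNIV \<Phi>"
    unfolding \<Phi>_def
    using transl(2)[OF continuous_on_lse continuous_on_minus[OF cont_adj[of UNIV]]]
    by (intro continuous_intros) simp
  have cont_G: "continuous_on UNIV G"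
    unfolding G_def
    using transl(2)[OF cont_ASM continuous_on_minus[OF cont_adj[of UNIV]]] by simp
  \<comment> \<open>The gradient inequality based at \<open>\<nu>\<close>, integrated from
    \<open>lse_diff_le\<close>; it takes the place of differentiation under the integral.\<close>
  have \<Phi>_diff: "\<Phi> \<nu> - \<Phi> \<mu> \<le> (\<nu> - \<mu>) \<bullet> (b - G \<nu>)" for \<mu> \<nu>
  proof -
    have "(\<integral>x. lse (y x - adjoint A \<nu>) \<partial>M) - (\<integral>x. lse (y x - adjoint A \<mu>) \<partial>M)
        = (\<integral>x. lse (y x - adjoint A \<nu>) - lse (y x - adjoint A \<mu>) \<partial>M)"
      using int_lse by simp
    also have "\<dots> \<le> (\<integral>x. A (softmean (y x - adjoint A \<nu>)) \<bullet> (\<mu> - \<nu>) \<partial>M)"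
    proof (rule integral_mono)
      fix x
      have "lse (y x - adjoint A \<nu>) - lse (y x - adjoint A \<mu>)
          \<le> softmean (y x - adjoint A \<nu>) \<bullet> adjoint A (\<mu> - \<nu>)"
        using lse_diff_le[of "y x - adjoint A \<nu>" "y x - adjoint A \<mu>"] by (simp add: linear_diff[OF adj])
      then show "lse (y x - adjoint A \<nu>) - lse (y x - adjoint A \<mu>)
          \<le> A (softmean (y x - adjoint A \<nu>)) \<bullet> (\<mu> - \<nu>)"
        by (simp add: adjoint_works[OF A])
    qed (use int_lse int_ASM in auto)
    also have "\<dots> = G \<nu> \<bullet> (\<mu> - \<nu>)"
      using int_ASM by (simp add: G_def)
    finally show ?thesis
      by (simp add: \<Phi>_def algebra_simps inner_commute)
  qed

  \<comment> \<open>Coercivity and a dual minimizer\<close>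
  define \<delta> where "\<delta> = b - (\<integral>x. A (\<eta> x) \<partial>M)"
  have \<delta>: "\<delta> $ j > 0" for j using slater[of j] by (simp add: \<delta>_def)
  define k where "k = (\<integral>x. \<eta> x \<bullet> y x \<partial>M)"
  obtain C where C: "\<And>p. p \<in> convex hull V \<Longrightarrow> norm p \<le> C"
    using compact_imp_bounded[OF finite_imp_compact_convex_hull[OF finite_V]]
    unfolding bounded_iff by blast
  have int_\<eta>: "integrable M \<eta>"
    using \<eta>_hull by (intro integrable_const_bound[of _ C]) (auto intro: C)
  have int_\<eta>y: "integrable M (\<lambda>x. \<eta> x \<bullet> y x)"
  proof (rule integrable_const_bound)
    show "AE x in M. norm (\<eta> x \<bullet> y x) \<le> \<bar>C\<bar> * \<bar>B\<bar>"
      using \<eta>_hull y_bound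
    proof eventually_elim
      case (elim x)
      have "norm (\<eta> x \<bullet> y x) \<le> norm (\<eta> x) * norm (y x)"
        by (simp add: Cauchy_Schwarz_ineq2)
      also have "\<dots> \<le> \<bar>C\<bar> * \<bar>B\<bar>"
        using elim C[of "\<eta> x"] by (intro mult_mono) auto
      finally show ?case .
    qed
  qed measurable
  \<comment> \<open>Integrating \<open>inner_le_lse\<close> at the strictly feasible point gives
    linear growth with slope the slack \<open>\<delta>\<close>, positive in every
    coordinate.\<close>
  have \<Phi>_ge: "k + \<mu> \<bullet> \<delta> \<le> \<Phi> \<mu>" for \<mu>
  proof -
    have int_A\<eta>: "integrable M (\<lambda>x. A (\<eta> x))"
      by (rule integrable_bounded_linear[OF A_bl int_\<eta>])
    have "k - \<mu> \<bullet> (\<integral>x. A (\<eta> x) \<partial>M) = (\<integral>x. \<eta> x \<bullet> y x - \<mu> \<bullet> A (\<eta> x) \<partial>M)"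
      using int_\<eta>y int_A\<eta> by (simp add: k_def)
    also have "\<dots> \<le> (\<integral>x. lse (y x - adjoint A \<mu>) \<partial>M)"
    proof (rule integral_mono_AE)
      show "AE x in M. \<eta> x \<bullet> y x - \<mu> \<bullet> A (\<eta> x) \<le> lse (y x - adjoint A \<mu>)"
        using \<eta>_hull
      proof eventually_elim
        case (elim x)
        from inner_le_lse[OF this, of "y x - adjoint A \<mu>"] show ?case
          by (simp add: inner_diff_right adjoint_works[OF A] inner_commute)
      qed
    qed (use int_\<eta>y int_A\<eta> int_lse in auto)
    finally show ?thesis by (simp add: \<Phi>_def \<delta>_def algebra_simps)
  qed
  define c where "c = \<Phi> 0 - k"
  have "c \<ge> 0" using \<Phi>_ge[of 0] by (simp add: c_def)
  \<comment> \<open>Box size: if some \<open>\<nu> $ j\<close> exceeds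
    \<open>c / \<delta> $ j\<close>, the linear growth already puts \<open>\<Phi> \<nu>\<close> at
    or above \<open>\<Phi> 0\<close>. A minimizer over the box therefore minimizes over the whole
    orthant.\<close>
  define u :: "real ^ 'r" where "u = (\<chi> j. c / \<delta> $ j)"
  have "0 \<in> cbox 0 u"
    using \<open>c \<ge> 0\<close> \<delta> by (simp add: mem_box_cart u_def less_imp_le)
  then obtain \<mu> where \<mu>_box: "\<mu> \<in> cbox 0 u" and \<mu>_min: "\<And>\<nu>. \<nu> \<in> cbox 0 u \<Longrightarrow> \<Phi> \<mu> \<le> \<Phi> \<nu>"
    using continuous_attains_inf[OF compact_cbox _ continuous_on_subset[OF cont_\<Phi>]]
    by (metis empty_iff subset_UNIV)
  have \<mu>_nonneg: "0 \<le> \<mu> $ j" for j using \<mu>_box by (simp add: mem_box_cart)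
  have min: "\<Phi> \<mu> \<le> \<Phi> \<nu>" if \<nu>: "\<And>j. 0 \<le> \<nu> $ j" for \<nu>
  proof (cases "\<nu> \<in> cbox 0 u")
    case False
    with \<nu> obtain j where "\<nu> $ j > c / \<delta> $ j"
      by (auto simp: mem_box_cart u_def not_le)
    then have "c < \<nu> $ j * \<delta> $ j"
      using \<delta>[of j] by (simp add: divide_less_eq)
    also have "\<dots> \<le> (\<Sum>i\<in>UNIV. \<nu> $ i * \<delta> $ i)"
      by (intro member_le_sum mult_nonneg_nonneg \<nu> less_imp_le[OF \<delta>]) auto
    also have "\<dots> = \<nu> \<bullet> \<delta>"
      by (simp add: inner_vec_def)
    finally have "\<Phi> 0 \<le> \<Phi> \<nu>" using \<Phi>_ge[of \<nu>] by (simp add: c_def)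
    with \<mu>_min[OF \<open>0 \<in> cbox 0 u\<close>] show ?thesis by simp
  qed (rule \<mu>_min)

  \<comment> \<open>Feasibility and complementarity from one-sided variations\<close>
  have lim: "((\<lambda>t. G (\<mu> + (s * t) *\<^sub>R axis j 1) $ j) \<longlongrightarrow> G \<mu> $ j) (at_right 0)" for j s
  proof -
    have "continuous_on UNIV (\<lambda>t. G (\<mu> + (s * t) *\<^sub>R axis j 1) $ j)"
      by (intro continuous_intros continuous_on_compose2[OF cont_G]) auto
    then have "isCont (\<lambda>t. G (\<mu> + (s * t) *\<^sub>R axis j 1) $ j) 0"
      by (simp add: continuous_on_eq_continuous_at)
    then show ?thesis
      by (auto simp: isCont_def intro: tendsto_within_subset)
  qed
  \<comment> \<open>Minimality of \<open>\<mu>\<close> meets the gradient inequality based at the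
    moved point, so \<open>G\<close> appears there and continuity must bring it back to
    \<open>\<mu>\<close>.\<close>
  have step: "0 \<le> s * t * (b $ j - G (\<mu> + (s * t) *\<^sub>R axis j 1) $ j)"
    if "0 \<le> \<mu> $ j + s * t" for s t j
  proof -
    have "\<Phi> \<mu> \<le> \<Phi> (\<mu> + (s * t) *\<^sub>R axis j 1)"
      using that \<mu>_nonneg by (intro min) (auto simp: axis_def)
    with \<Phi>_diff[of "\<mu> + (s * t) *\<^sub>R axis j 1" \<mu>] show ?thesis
      by (simp add: inner_axis' algebra_simps)
  qed
  have G_le: "G \<mu> $ j \<le> b $ j" for j
  proof (rule tendsto_upperbound[OF lim[of 1]])
    show "\<forall>\<^sub>F t in at_right 0. G (\<mu> + (1 * t) *\<^sub>R axis j 1) $ j \<le> b $ j"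
      unfolding eventually_at_right_field
    proof (intro exI[of _ 1] conjI allI impI)
      fix t :: real assume "0 < t"
      with step[of j 1 t] \<mu>_nonneg[of j] show "G (\<mu> + (1 * t) *\<^sub>R axis j 1) $ j \<le> b $ j"
        by (simp add: zero_le_mult_iff)
    qed simp
  qed simp
  \<comment> \<open>A backward step stays in the orthant only if \<open>\<mu> $ j\<close> is
    positive and \<open>t\<close> is smaller than it.\<close>
  have G_ge: "b $ j \<le> G \<mu> $ j" if "\<mu> $ j > 0" for j
  proof (rule tendsto_lowerbound[OF lim[of "- 1"]])
    show "\<forall>\<^sub>F t in at_right 0. b $ j \<le> G (\<mu> + (- 1 * t) *\<^sub>R axis j 1) $ j"
      unfolding eventually_at_right_field
    proof (intro exI[of _ "\<mu> $ j"] conjI allI impI)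
      fix t :: real assume "0 < t" "t < \<mu> $ j"
      with step[of j "- 1" t] show "b $ j \<le> G (\<mu> + (- 1 * t) *\<^sub>R axis j 1) $ j"
        by (simp add: mult_le_0_iff)
    qed (rule that)
  qed simp
  have "\<mu> \<bullet> G \<mu> = \<mu> \<bullet> b"
    unfolding inner_vec_def
  proof (rule sum.cong)
    fix j
    show "\<mu> $ j \<bullet> G \<mu> $ j = \<mu> $ j \<bullet> b $ j"
      using G_le[of j] G_ge[of j] \<mu>_nonneg[of j] by (cases "\<mu> $ j = 0") auto
  qed simp
  with \<mu>_nonneg G_le show ?thesis
    unfolding G_def by (rule that)
qed

section \<open>Essentially bounded functions and extended-real integrals\<close>

lemma Linf_iff:
  "f \<in> Linf \<Omega> \<longleftrightarrow> f \<in> borel_measurable (lebesgue_on \<Omega>) \<and> (\<exists>B. AE x in lebesgue_on \<Omega>. norm (f x) \<le> B)"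
proof (intro iffI conjI; (elim conjE exE)?)
  assume f: "f \<in> Linf \<Omega>"
  show "f \<in> borel_measurable (lebesgue_on \<Omega>)" using f by (simp add: Linf_def)
  have "AE x in lebesgue_on \<Omega>. ereal (norm (f x)) \<le> esssup (lebesgue_on \<Omega>) (\<lambda>x. ereal (norm (f x)))"
    by (rule esssup_AE)
  then have "AE x in lebesgue_on \<Omega>.
      norm (f x) \<le> real_of_ereal (esssup (lebesgue_on \<Omega>) (\<lambda>x. ereal (norm (f x))))"
    using f by (cases "esssup (lebesgue_on \<Omega>) (\<lambda>x. ereal (norm (f x)))") (auto simp: Linf_def)
  then show "\<exists>B. AE x in lebesgue_on \<Omega>. norm (f x) \<le> B" ..
next
  fix B assume [measurable]: "f \<in> borel_measurable (lebesgue_on \<Omega>)"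
    and B: "AE x in lebesgue_on \<Omega>. norm (f x) \<le> B"
  have "esssup (lebesgue_on \<Omega>) (\<lambda>x. ereal (norm (f x))) \<le> ereal B"
    using B by (intro esssup_I) auto
  then show "f \<in> Linf \<Omega>" by (auto simp: Linf_def)
qed

lemma Linf_subset_L1:
  assumes "finite_measure (lebesgue_on \<Omega>)"
  shows "Linf \<Omega> \<subseteq> L1 \<Omega>"
  using finite_measure.integrable_const_bound[OF assms] by (auto simp: Linf_iff L1_def)

lemma essinf_ge:
  assumes "f \<in> borel_measurable M" "AE x in M. c \<le> f x"
  shows "c \<le> essinf M f"
proof -
  have "esssup M (\<lambda>x. - f x) \<le> - c"
    using assms by (intro esssup_I) auto
  then show ?thesis unfolding essinf_def by (metis ereal_minus_le_minus ereal_uminus_uminus)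
qed

lemma ext_integral_ereal:
  assumes "integrable M h"
  shows "ext_integral M (\<lambda>x. ereal (h x)) = ereal (\<integral>x. h x \<partial>M)"
proof -
  have fin: "(\<integral>\<^sup>+ x. ennreal (h x) \<partial>M) < \<infinity>" "(\<integral>\<^sup>+ x. ennreal (- h x) \<partial>M) < \<infinity>"
    using assms by (simp_all add: real_integrable_def less_top)
  then show ?thesis
    unfolding ext_integral_def real_lebesgue_integral_def[OF assms]
    by (cases "\<integral>\<^sup>+ x. ennreal (h x) \<partial>M"; cases "\<integral>\<^sup>+ x. ennreal (- h x) \<partial>M")
       (auto simp: e2ennreal_ereal)
qed

text \<open>Subtraction in \<open>ereal\<close> is monotone for infinite values too, so competitors
  of infinite cost need no separate case.\<close>

lemma ext_integral_mono_AE: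
  assumes "AE x in M. f x \<le> g x"
  shows "ext_integral M f \<le> ext_integral M g"
  unfolding ext_integral_def
proof (intro ereal_minus_mono)
  show "enn2ereal (\<integral>\<^sup>+ x. e2ennreal (f x) \<partial>M) \<le> enn2ereal (\<integral>\<^sup>+ x. e2ennreal (g x) \<partial>M)"
    using assms by (auto intro!: nn_integral_mono_AE e2ennreal_mono simp flip: less_eq_ennreal.rep_eq elim: eventually_mono)
  show "enn2ereal (\<integral>\<^sup>+ x. e2ennreal (- g x) \<partial>M) \<le> enn2ereal (\<integral>\<^sup>+ x. e2ennreal (- f x) \<partial>M)"
    using assms by (auto intro!: nn_integral_mono_AE e2ennreal_mono simp flip: less_eq_ennreal.rep_eq elim: eventually_mono)
qed

lemma ext_integral_cong_AE:
  assumes "AE x in M. f x = g x"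
  shows "ext_integral M f = ext_integral M g"
  using assms by (intro antisym ext_integral_mono_AE) (auto elim: eventually_mono)

section \<open>The minimization problem\<close>

text \<open>At the optimality point \<open>z = \<nabla>R(q) - \<alpha> g - w\<close> the Lagrangian integrand
  \<open>\<alpha> g \<bullet> p + D\<^sub>R(p, q) + w \<bullet> p\<close> is minimized by \<open>p = softmean z\<close>, with quadratic growth.\<close>

lemma (in solid_polytope) bregman_integrand_bounds:
  assumes q: "R q = ereal r" and z: "z = gradient R q - \<alpha> *\<^sub>R g - w"
  shows "ereal (p \<bullet> z - lse z + k) \<le> R p \<Longrightarrow>
      ereal (gradient R q \<bullet> q - r - lse z - w \<bullet> p + k) \<le> ereal (\<alpha> * (g \<bullet> p)) + bregman R p q"
    and "ereal (\<alpha> * (g \<bullet> softmean z)) + bregman R (softmean z) q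
      = ereal (gradient R q \<bullet> q - r - lse z - w \<bullet> softmean z)"
proof -
  have inner_z: "u \<bullet> z = u \<bullet> gradient R q - \<alpha> * (u \<bullet> g) - u \<bullet> w" for u
    by (simp add: z inner_diff_right)
  show "ereal (gradient R q \<bullet> q - r - lse z - w \<bullet> p + k) \<le> ereal (\<alpha> * (g \<bullet> p)) + bregman R p q"
    if "ereal (p \<bullet> z - lse z + k) \<le> R p"
    using that unfolding bregman_def q inner_z
    by (cases "R p") (auto simp: inner_diff_left inner_diff_right inner_commute)
  show "ereal (\<alpha> * (g \<bullet> softmean z)) + bregman R (softmean z) q
      = ereal (gradient R q \<bullet> q - r - lse z - w \<bullet> softmean z)"
    unfolding bregman_def q R_softmean inner_z
    by (auto simp: inner_diff_left inner_diff_right inner_commute)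
qed

theorem corollary4p5:
  fixes \<Omega> :: "(real ^ 'd) set"
    and P :: "(real ^ 'n) set"
    and R :: "real ^ 'n \<Rightarrow> ereal"
    and W :: "real ^ 'n ^ 'r"
    and b :: "real ^ 'r"
    and F :: "(real ^ 'd \<Rightarrow> real ^ 'n) \<Rightarrow> real"
    and F' :: "(real ^ 'd \<Rightarrow> real ^ 'n) \<Rightarrow> (real ^ 'd \<Rightarrow> real ^ 'n) \<Rightarrow> real"
    and gradF :: "(real ^ 'd \<Rightarrow> real ^ 'n) \<Rightarrow> (real ^ 'd \<Rightarrow> real ^ 'n)"
    and v :: "real ^ 'd \<Rightarrow> real ^ 'n"
    and \<alpha> :: real
  assumes "open \<Omega>" and "connected \<Omega>" and "\<Omega> \<noteq> {}" and "emeasure lebesgue \<Omega> < \<infinity>"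
    and "polytope P" and "interior P \<noteq> {}"
    and "R = polytopal_legendre P"
    and slater: "\<exists>\<eta> \<in> borel_measurable (lebesgue_on \<Omega>).
          (AE x in lebesgue_on \<Omega>. \<eta> x \<in> P) \<and> vec_less (W_integral \<Omega> W \<eta>) b"
    and "Linf_functional \<Omega> F"
    and "\<forall>\<eta> \<in> A_set \<Omega> P W b \<union> {v}. has_frechet_derivative_Linf \<Omega> F (F' \<eta>) \<eta>"
    and "continuous_into_dual \<Omega> (A_set \<Omega> P W b) F'"
    and "\<forall>\<eta> \<in> A_set \<Omega> P W b \<union> {v}. represents_functional \<Omega> (gradF \<eta>) (F' \<eta>)"
    and "v \<in> K_ring \<Omega> P" and "(\<lambda>x. gradient R (v x)) \<in> Linf \<Omega>"
    and "\<alpha> > 0"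
  shows "\<exists>\<eta>. is_unique_minimizer_ae \<Omega> (M1_set \<Omega> W b) (objective \<Omega> R \<alpha> (gradF v) v) \<eta>
           \<and> \<eta> \<in> K_ring \<Omega> P
           \<and> (\<lambda>x. gradient R (\<eta> x)) \<in> Linf \<Omega>
           \<and> is_unique_minimizer_ae \<Omega> (M_set \<Omega> W b) (objective \<Omega> R \<alpha> (gradF v) v) \<eta>"
proof -

  \<comment> \<open>Bounded data and a strictly feasible point\<close>
  define M where "M = lebesgue_on \<Omega>"
  have M: "finite_measure M"
    unfolding M_def using assms(1,4) by (intro finite_measure_lebesgue_on fmeasurableI) auto
  interpret finite_measure M by (rule M)
  interpret solid_polytope P by unfold_locales (rule assms)+
  note R_def = assms(7)
  define g where "g = gradF v"
  define h where "h x = gradient (polytopal_legendre P) (v x)" for x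
  have "g \<in> Linf \<Omega>" using assms(12) by (simp add: represents_functional_def g_def)
  then obtain Bg where g [measurable]: "g \<in> borel_measurable M" and Bg: "AE x in M. norm (g x) \<le> Bg"
    unfolding Linf_iff M_def by blast
  have "h \<in> Linf \<Omega>" using assms(14) by (simp add: h_def[abs_def] R_def)
  then obtain Bh where h [measurable]: "h \<in> borel_measurable M" and Bh: "AE x in M. norm (h x) \<le> Bh"
    unfolding Linf_iff M_def by blast
  have "v \<in> Linf \<Omega>" and v_P: "AE x in M. v x \<in> P"
    using assms(13) unfolding K_ring_def K_set_def M_def by auto
  then obtain Bv where v [measurable]: "v \<in> borel_measurable M" and Bv: "AE x in M. norm (v x) \<le> Bv"
    unfolding Linf_iff M_def by blast
  obtain \<eta>\<^sub>0 where \<eta>0: "\<eta>\<^sub>0 \<in> borel_measurable M" "AE x in M. \<eta>\<^sub>0 x \<in> P" "vec_less (W_integral \<Omega> W \<eta>\<^sub>0) b"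
    using slater unfolding M_def by blast

  \<comment> \<open>Multiplier and candidate minimizer\<close>
  define y where "y x = h x - \<alpha> *\<^sub>R g x" for x
  have y [measurable]: "y \<in> borel_measurable M" unfolding y_def by measurable
  have y_bound: "AE x in M. norm (y x) \<le> Bh + \<bar>\<alpha>\<bar> * Bg"
    using Bg Bh unfolding y_def
  proof eventually_elim
    case (elim x)
    have "norm (h x - \<alpha> *\<^sub>R g x) \<le> norm (h x) + \<bar>\<alpha>\<bar> * norm (g x)"
      using norm_triangle_ineq4[of "h x" "\<alpha> *\<^sub>R g x"] by simp
    also have "\<dots> \<le> Bh + \<bar>\<alpha>\<bar> * Bg"
      using elim by (intro add_mono mult_left_mono) auto
    finally show ?case .
  qed
  have A: "linear ((*v) W)" by simp
  obtain \<mu> where \<mu>: "\<And>j. 0 \<le> \<mu> $ j"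
    "\<And>j. (\<integral>x. W *v softmean (y x - adjoint ((*v) W) \<mu>) \<partial>M) $ j \<le> b $ j"
    "\<mu> \<bullet> (\<integral>x. W *v softmean (y x - adjoint ((*v) W) \<mu>) \<partial>M) = \<mu> \<bullet> b"
    using exists_multiplier[OF M A y y_bound \<eta>0(1), of b] \<eta>0(2,3)
    by (auto simp: convex_hull_V vec_less_def W_integral_def M_def)
  define w where "w = adjoint ((*v) W) \<mu>"
  define z where "z x = y x - w" for x
  define \<eta> where "\<eta> x = softmean (z x)" for x
  have z [measurable]: "z \<in> borel_measurable M" unfolding z_def by measurable
  define B where "B = Bh + \<bar>\<alpha>\<bar> * Bg + norm w"
  have z_bound: "AE x in M. norm (z x) \<le> B"
    using y_bound unfolding z_def B_def
    by eventually_elim (rule norm_triangle_le_diff, simp)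
  have z_Linf: "z \<in> Linf \<Omega>" using z z_bound unfolding Linf_iff M_def by blast
  have [measurable]: "softmean \<in> borel_measurable borel" "lse \<in> borel_measurable borel"
    by (auto intro: borel_measurable_continuous_onI continuous_on_softmean continuous_on_lse)
  have \<eta> [measurable]: "\<eta> \<in> borel_measurable M" unfolding \<eta>_def by measurable
  have \<eta>_P: "\<eta> x \<in> P" for x by (simp add: \<eta>_def softmean_in_P)
  obtain C where C: "\<And>p. p \<in> P \<Longrightarrow> norm p \<le> C"
    using polytope_imp_bounded[OF polytope] unfolding bounded_iff by blast
  have \<eta>_Linf: "\<eta> \<in> Linf \<Omega>"
    using \<eta> C[OF \<eta>_P] unfolding Linf_iff M_def by auto

  \<comment> \<open>Uniform distance from the frontier and bounded gradient\<close>
  have \<eta>_ring: "\<eta> \<in> K_ring \<Omega> P"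
  proof -
    \<comment> \<open>The distance \<open>e\<close> depends only on the essential bound
      \<open>B\<close> of \<open>z\<close>, hence is uniform in \<open>x\<close>.\<close>
    obtain e where e: "e > 0" "\<And>y. norm y \<le> B \<Longrightarrow> e \<le> infdist (softmean y) (frontier P)"
      using infdist_softmean_frontier by blast
    have "continuous_on UNIV (\<lambda>p. infdist p (frontier P))"
      by (intro continuous_intros)
    from borel_measurable_continuous_onI[OF this]
    have [measurable]: "(\<lambda>p. infdist p (frontier P)) \<in> borel_measurable borel" .
    have "ereal e \<le> essinf M (\<lambda>x. ereal (infdist (\<eta> x) (frontier P)))"
    proof (rule essinf_ge)
      show "AE x in M. ereal e \<le> ereal (infdist (\<eta> x) (frontier P))"
        using z_bound by eventually_elim (simp add: \<eta>_def e)
    qed measurable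
    with e(1) have "0 < essinf M (\<lambda>x. ereal (infdist (\<eta> x) (frontier P)))"
      by (metis ereal_less(2) less_le_trans)
    with \<eta>_Linf \<eta>_P show ?thesis
      unfolding K_ring_def K_set_def M_def by simp
  qed
  have gradient_\<eta>: "(\<lambda>x. gradient R (\<eta> x)) = z"
    by (simp add: fun_eq_iff R_def \<eta>_def gradient_R_softmean)

  \<comment> \<open>Integrability of the Lagrangian terms\<close>
  define r where "r x = real_of_ereal (polytopal_legendre P (v x))" for x
  have r [measurable]: "r \<in> borel_measurable M" unfolding r_def by measurable
  have R_v: "polytopal_legendre P (v x) = ereal (r x) \<and> \<bar>r x\<bar> \<le> \<bar>lse 0\<bar>" if "v x \<in> P" for x
    using R_bounds[OF that] by (cases "polytopal_legendre P (v x)") (auto simp: r_def)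
  \<comment> \<open>The pointwise minimum of the Lagrangian integrand over all values
    \<open>p\<close>, attained at \<open>\<eta> x\<close>.\<close>
  define base where "base x = h x \<bullet> v x - r x - lse (z x)" for x
  have int_lse: "integrable M (\<lambda>x. lse (z x))"
    using integrable_continuous_translate[OF M z z_bound continuous_on_lse, of 0] by simp
  have int_r: "integrable M r"
    using v_P by (intro integrable_const_bound[of _ "\<bar>lse 0\<bar>"]) (auto dest: R_v)
  have int_hv: "integrable M (\<lambda>x. h x \<bullet> v x)"
  proof (rule integrable_const_bound)
    show "AE x in M. norm (h x \<bullet> v x) \<le> \<bar>Bh\<bar> * \<bar>Bv\<bar>"
      using Bh Bv
    proof eventually_elim
      case (elim x)
      have "norm (h x \<bullet> v x) \<le> norm (h x) * norm (v x)"
        by (simp add: Cauchy_Schwarz_ineq2)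
      also have "\<dots> \<le> \<bar>Bh\<bar> * \<bar>Bv\<bar>"
        using elim by (intro mult_mono) auto
      finally show ?case .
    qed
  qed measurable
  have int_base: "integrable M base"
    unfolding base_def using int_lse int_r int_hv by auto
  \<comment> \<open>Moving the adjoint across the integral converts the pointwise term in
    \<open>w\<close> into the multiplier paired with the constraint.\<close>
  have w_integral: "integrable M (\<lambda>x. w \<bullet> \<zeta> x)"
      "(\<integral>x. w \<bullet> \<zeta> x \<partial>M) = \<mu> \<bullet> W_integral \<Omega> W \<zeta>" if "\<zeta> \<in> L1 \<Omega>" for \<zeta>
  proof -
    have int: "integrable M \<zeta>" using that by (simp add: L1_def M_def)
    then show "integrable M (\<lambda>x. w \<bullet> \<zeta> x)" by simp
    have "(\<integral>x. w \<bullet> \<zeta> x \<partial>M) = (\<integral>x. \<zeta> x \<partial>M) \<bullet> w"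
      using int by (simp add: inner_commute)
    also have "\<dots> = (W *v (\<integral>x. \<zeta> x \<partial>M)) \<bullet> \<mu>"
      unfolding w_def by (rule adjoint_works[OF A])
    also have "W *v (\<integral>x. \<zeta> x \<partial>M) = (\<integral>x. W *v \<zeta> x \<partial>M)"
      using int by (intro integral_bounded_linear[symmetric] matrix_vector_mul_bounded_linear)
    finally show "(\<integral>x. w \<bullet> \<zeta> x \<partial>M) = \<mu> \<bullet> W_integral \<Omega> W \<zeta>"
      by (simp add: W_integral_def M_def inner_commute)
  qed
  have \<eta>_L1: "\<eta> \<in> L1 \<Omega>"
    using \<eta>_Linf Linf_subset_L1 M by (auto simp: M_def)
  have W_\<eta>: "vec_le (W_integral \<Omega> W \<eta>) b" "\<mu> \<bullet> W_integral \<Omega> W \<eta> = \<mu> \<bullet> b"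
    using \<mu>(2,3) by (auto simp: vec_le_def W_integral_def M_def \<eta>_def[abs_def] z_def w_def)

  \<comment> \<open>Value of the objective at the candidate\<close>
  let ?J = "objective \<Omega> R \<alpha> (gradF v) v"
  \<comment> \<open>Complementarity replaces the integral of \<open>w \<bullet> \<eta> x\<close> by
    \<open>\<mu> \<bullet> b\<close>; the value is finite, which later allows cancellation.\<close>
  have J_\<eta>: "?J \<eta> = ereal ((\<integral>x. base x \<partial>M) - \<mu> \<bullet> b)"
  proof -
    have "AE x in M. ereal (\<alpha> * (g x \<bullet> \<eta> x)) + bregman R (\<eta> x) (v x) = ereal (base x - w \<bullet> \<eta> x)"
      using v_P
    proof eventually_elim
      case (elim x)
      have "z x = gradient (polytopal_legendre P) (v x) - \<alpha> *\<^sub>R g x - w"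
        by (simp add: z_def y_def h_def)
      from bregman_integrand_bounds(2)[OF conjunct1[OF R_v[OF elim]] this] show ?case
        by (simp add: base_def h_def \<eta>_def R_def)
    qed
    then have "?J \<eta> = ext_integral M (\<lambda>x. ereal (base x - w \<bullet> \<eta> x))"
      unfolding objective_def M_def[symmetric] g_def[symmetric] by (rule ext_integral_cong_AE)
    also have "\<dots> = ereal ((\<integral>x. base x \<partial>M) - (\<integral>x. w \<bullet> \<eta> x \<partial>M))"
      using int_base w_integral(1)[OF \<eta>_L1] by (simp add: ext_integral_ereal)
    finally show ?thesis
      by (simp add: w_integral(2)[OF \<eta>_L1] W_\<eta>)
  qed

  \<comment> \<open>Growth of the objective over feasible competitors\<close>
  obtain c where "c > 0" and c: "\<And>p z. ereal (p \<bullet> z - lse z + c * (norm (p - softmean z))\<^sup>2)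
      \<le> polytopal_legendre P p"
    using R_ge_quadratic by blast
  text \<open>The cap keeps the growth term integrable for competitors that are merely \<open>L\<^sup>1\<close>.\<close>
  define growth where "growth \<zeta> x = min 1 (c * (norm (\<zeta> x - \<eta> x))\<^sup>2)" for \<zeta> x
  have growth_nonneg: "0 \<le> growth \<zeta> x" for \<zeta> x
    using \<open>c > 0\<close> by (simp add: growth_def)
  have int_growth: "integrable M (growth \<zeta>)" if "\<zeta> \<in> L1 \<Omega>" for \<zeta>
  proof (rule integrable_const_bound[of _ 1])
    have [measurable]: "\<zeta> \<in> borel_measurable M" using that by (auto simp: L1_def M_def)
    show "growth \<zeta> \<in> borel_measurable M" unfolding growth_def by measurable
    show "AE x in M. norm (growth \<zeta> x) \<le> 1"
      using growth_nonneg by (auto simp: growth_def)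
  qed
  \<comment> \<open>Weak duality with a remainder: \<open>\<mu>\<close> is nonnegative and
    \<open>\<zeta>\<close> feasible, so its constraint term is at most
    \<open>\<mu> \<bullet> b\<close>, and the pointwise Lagrangian bound can be integrated.\<close>
  have J_ge: "?J \<eta> + ereal (\<integral>x. growth \<zeta> x \<partial>M) \<le> ?J \<zeta>" if "\<zeta> \<in> M1_set \<Omega> W b" for \<zeta>
  proof -
    have \<zeta>: "\<zeta> \<in> L1 \<Omega>" and W_\<zeta>: "vec_le (W_integral \<Omega> W \<zeta>) b"
      using that by (auto simp: M1_set_def)
    have "\<mu> \<bullet> W_integral \<Omega> W \<zeta> \<le> \<mu> \<bullet> b"
      unfolding inner_vec_def using W_\<zeta> \<mu>(1) by (auto simp: vec_le_def intro!: sum_mono mult_left_mono)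
    then have "?J \<eta> + ereal (\<integral>x. growth \<zeta> x \<partial>M)
        \<le> ereal ((\<integral>x. base x \<partial>M) - (\<integral>x. w \<bullet> \<zeta> x \<partial>M) + (\<integral>x. growth \<zeta> x \<partial>M))"
      by (simp add: J_\<eta> w_integral(2)[OF \<zeta>])
    also have "\<dots> = ext_integral M (\<lambda>x. ereal (base x - w \<bullet> \<zeta> x + growth \<zeta> x))"
      using int_base w_integral(1)[OF \<zeta>] int_growth[OF \<zeta>] by (simp add: ext_integral_ereal)
    also have "\<dots> \<le> ?J \<zeta>"
      unfolding objective_def M_def[symmetric] g_def[symmetric]
    proof (rule ext_integral_mono_AE)
      show "AE x in M. ereal (base x - w \<bullet> \<zeta> x + growth \<zeta> x)
          \<le> ereal (\<alpha> * (g x \<bullet> \<zeta> x)) + bregman R (\<zeta> x) (v x)"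
        using v_P
      proof eventually_elim
        case (elim x)
        have z_x: "z x = gradient (polytopal_legendre P) (v x) - \<alpha> *\<^sub>R g x - w"
          by (simp add: z_def y_def h_def)
        have "ereal (\<zeta> x \<bullet> z x - lse (z x) + growth \<zeta> x) \<le> polytopal_legendre P (\<zeta> x)"
          by (rule order_trans[OF _ c[of _ "z x"]]) (simp add: growth_def \<eta>_def)
        from bregman_integrand_bounds(1)[OF conjunct1[OF R_v[OF elim]] z_x this] show ?case
          by (simp add: base_def h_def R_def)
      qed
    qed
    finally show ?thesis .
  qed

  \<comment> \<open>Uniqueness for any feasible class containing the candidate\<close>
  have unique: "is_unique_minimizer_ae \<Omega> S ?J \<eta>" if S: "S \<subseteq> M1_set \<Omega> W b" "\<eta> \<in> S" for S
    unfolding is_unique_minimizer_ae_def is_minimizer_def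
  proof (intro conjI ballI allI impI)
    fix \<zeta> assume "\<zeta> \<in> S"
    have "?J \<eta> \<le> ?J \<eta> + ereal (\<integral>x. growth \<zeta> x \<partial>M)"
      by (simp add: J_\<eta> growth_nonneg)
    also have "\<dots> \<le> ?J \<zeta>" using \<open>\<zeta> \<in> S\<close> S by (intro J_ge) auto
    finally show "?J \<eta> \<le> ?J \<zeta>" .
  next
    fix \<zeta> assume *: "\<zeta> \<in> S \<and> (\<forall>\<xi>\<in>S. ?J \<zeta> \<le> ?J \<xi>)"
    then have \<zeta>: "\<zeta> \<in> M1_set \<Omega> W b" using S by auto
    \<comment> \<open>Another minimizer costs no more than \<open>\<eta>\<close>, so the growth
      integral vanishes; since \<open>c > 0\<close>, zero growth forces equality almost
      everywhere.\<close>
    have "?J \<eta> + ereal (\<integral>x. growth \<zeta> x \<partial>M) \<le> ?J \<eta>"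
      using J_ge[OF \<zeta>] * S(2) order_trans by blast
    then have "(\<integral>x. growth \<zeta> x \<partial>M) \<le> 0" by (simp add: J_\<eta>)
    then have "(\<integral>x. growth \<zeta> x \<partial>M) = 0"
      by (intro antisym Bochner_Integration.integral_nonneg growth_nonneg)
    then have "AE x in M. growth \<zeta> x = 0"
      using \<zeta> growth_nonneg by (subst (asm) integral_nonneg_eq_0_iff_AE) (auto intro: int_growth simp: M1_set_def)
    then show "AE x in lebesgue_on \<Omega>. \<zeta> x = \<eta> x"
      unfolding M_def[symmetric]
      by eventually_elim (use \<open>c > 0\<close> in \<open>auto simp: growth_def min_def split: if_splits\<close>)
  qed (rule S(2))
  \<comment> \<open>The bounded feasible functions form a subclass of the integrable ones that still
    contains \<open>\<eta>\<close>, so \<open>unique\<close> serves both problems.\<close>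
  have "M_set \<Omega> W b \<subseteq> M1_set \<Omega> W b"
    using Linf_subset_L1 M by (auto simp: M_set_def M1_set_def M_def)
  moreover have "\<eta> \<in> M_set \<Omega> W b"
    using \<eta>_Linf W_\<eta>(1) by (simp add: M_set_def)
  ultimately show ?thesis
    using \<eta>_ring z_Linf unique gradient_\<eta> by (intro exI[of _ \<eta>]) auto
qed

end
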